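(* Let $w\colon \mathbb{N}\rightarrow \mathbb{R}$ be a nonnegative function. The $w$-energy form $(\mathcal{E}_w,\mathsf{D}_w)$ is a Dirichlet form in $L^2(\Omega)$.
   Context: $\mathbb{N}$ denotes the set of nonnegative integers and $\Gamma$ the set of all finite subsets of $\mathbb{N}$ (including $\emptyset$). Let $\Omega=\{-1,1\}^{\mathbb{N}}$, let $\zeta_n(\omega)=\omega(n)$ ($n\geq 0$) be the canonical projections, and let $\mathscr{F}$ be the $\sigma$-field on $\Omega$ generated by $(\zeta_n)_{n\geq 0}$. Let $(p_n)_{n\geq 0}$ be a given sequence with $0<p_n<1$ for all $n$, and put $q_n=1-p_n$. Let $\mathbb{P}$ be the unique probability measure on $\mathscr{F}$ under which the $\zeta_n$ are independent with $\mathbb{P}\{\zeta_n=1\}=p_n$, $\mathbb{P}\{\zeta_n=-1\}=q_n$. Set $Z_n = \dfrac{\zeta_n+q_n-p_n}{2\sqrt{p_nq_n}}$, $Z_\emptyset=1$, and $Z_\sigma=\prod_{j\in\sigma}Z_j$ for nonempty $\sigma\in\Gamma$. $L^2(\Omega)=L^2(\Omega,\mathscr{F},\mathbb{P})$ is the real Hilbert space of square integrable random variables, with inner product $\langle\cdot,\cdot\rangle$ and norm $\|\cdot\|$. It is known that $\{Z_\sigma\mid\sigma\in\Gamma\}$ is an orthonormal basis of $L^2(\Omega)$. For $k\in\mathbb{N}$, the annihilation operator $\partial_k$ is the (unique) bounded linear operator on $L^2(\Omega)$ with $\partial_kZ_\sigma=\mathbf{1}_\sigma(k)Z_{\sigma\setminus\{k\}}$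 for all $\sigma\in\Gamma$, where $\mathbf{1}_\sigma$ is the indicator of $\sigma\subset\mathbb{N}$. For a nonnegative function $w\colon\mathbb{N}\to\mathbb{R}$, $\#_w(\sigma)=\sum_{j\in\sigma}w(j)$ for $\sigma\in\Gamma$, with $\#_w(\emptyset)=0$. Put $\mathsf{D}_w=\{\xi\in L^2(\Omega)\mid\sum_{\sigma\in\Gamma}\#_w(\sigma)|\langle Z_\sigma,\xi\rangle|^2<\infty\}$, a linear subspace of $L^2(\Omega)$. The $w$-energy form is $(\mathcal{E}_w,\mathsf{D}_w)$, where $$\mathcal{E}_w(\xi,\eta)=\sum_{k=0}^\infty w(k)\langle\partial_k\xi,\partial_k\eta\rangle,\quad \xi,\eta\in\mathsf{D}_w$$ (the series converges absolutely). A contraction function is a function $C\colon\mathbb{R}\to\mathbb{R}$ with $C(0)=0$ and $|C(s)-C(t)|\leq|s-t|$ for all $s,t\in\mathbb{R}$. A Dirichlet form in a (real) $L^2$-space $H$ with inner product $\langle\cdot,\cdot\rangle$ is a bilinear form $\mathcal{E}$ on a linear subspace $\mathsf{D}\subset H$ that is: densely defined ($\mathsf{D}$ is dense in $H$); symmetric; positive ($\mathcal{E}(\xi,\xi)\geq0$ for all $\xi\in\mathsf{D}$); closed ($\mathsf{D}$ with the inner product $\mathcal{E}(\xi,\eta)+\langle\xi,\eta\rangle$ is a Hilbert space); and has the contraction property (for every contraction function $C$ and every $\xi\in\mathsf{D}$, $C\circ\xi\in\mathsf{D}$ and $\mathcal{E}(C\circ\xi,C\circ\xi)\leq\mathcal{E}(\xi,\xi)$).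 *)

theory Defs
  imports "HOL-Probability.Probability"
begin

section \<open>\<open>L\<^sup>2\<close>-spaces and Dirichlet forms\<close>

text \<open>
  An element of \<open>L\<^sup>2(M)\<close> is given by a representative, that is, by a measurable
  square integrable function; two functions denote the same element if they agree
  almost everywhere. Accordingly, subspaces are required to be closed under almost everywhere
  equality, operators and forms to respect it, and all equations between elements
  of \<open>L\<^sup>2(M)\<close> are equations almost everywhere.
\<close>

definition l2 :: "'a measure \<Rightarrow> ('a \<Rightarrow> real) set" where
  "l2 M = {f \<in> borel_measurable M. integrable M (\<lambda>x. (f x)\<^sup>2)}"

definition l2_inner :: "'a measure \<Rightarrow> ('a \<Rightarrow> real) \<Rightarrow> ('a \<Rightarrow> real) \<Rightarrow> real" where
  "l2_inner M f g = (\<integral>x. f x * g x \<partial>M)"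

definition l2_norm :: "'a measure \<Rightarrow> ('a \<Rightarrow> real) \<Rightarrow> real" where
  "l2_norm M f = sqrt (l2_inner M f f)"

definition l2_subspace :: "'a measure \<Rightarrow> ('a \<Rightarrow> real) set \<Rightarrow> bool" where
  "l2_subspace M D \<longleftrightarrow>
     D \<subseteq> l2 M \<and>
     (\<forall>f\<in>D. \<forall>g\<in>l2 M. (AE x in M. f x = g x) \<longrightarrow> g \<in> D) \<and>
     (\<lambda>x. 0) \<in> D \<and>
     (\<forall>f\<in>D. \<forall>g\<in>D. (\<lambda>x. f x + g x) \<in> D) \<and>
     (\<forall>f\<in>D. \<forall>a. (\<lambda>x. a * f x) \<in> D)"

definition l2_dense :: "'a measure \<Rightarrow> ('a \<Rightarrow> real) set \<Rightarrow> bool" where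
  "l2_dense M D \<longleftrightarrow> (\<forall>f\<in>l2 M. \<forall>e>0. \<exists>g\<in>D. l2_norm M (\<lambda>x. f x - g x) < e)"

definition l2_bounded_linear :: "'a measure \<Rightarrow> (('a \<Rightarrow> real) \<Rightarrow> ('a \<Rightarrow> real)) \<Rightarrow> bool" where
  "l2_bounded_linear M T \<longleftrightarrow>
     (\<forall>f\<in>l2 M. T f \<in> l2 M) \<and>
     (\<forall>f\<in>l2 M. \<forall>g\<in>l2 M. (AE x in M. f x = g x) \<longrightarrow> (AE x in M. T f x = T g x)) \<and>
     (\<forall>f\<in>l2 M. \<forall>g\<in>l2 M. AE x in M. T (\<lambda>y. f y + g y) x = T f x + T g x) \<and>
     (\<forall>f\<in>l2 M. \<forall>a. AE x in M. T (\<lambda>y. a * f y) x = a * T f x) \<and>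
     (\<exists>K. \<forall>f\<in>l2 M. l2_norm M (T f) \<le> K * l2_norm M f)"

definition bilinear_form_on ::
  "'a measure \<Rightarrow> ('a \<Rightarrow> real) set \<Rightarrow> (('a \<Rightarrow> real) \<Rightarrow> ('a \<Rightarrow> real) \<Rightarrow> real) \<Rightarrow> bool" where
  "bilinear_form_on M D E \<longleftrightarrow>
     (\<forall>f\<in>D. \<forall>f'\<in>D. \<forall>g\<in>D. \<forall>g'\<in>D.
        (AE x in M. f x = f' x) \<longrightarrow> (AE x in M. g x = g' x) \<longrightarrow> E f g = E f' g') \<and>
     (\<forall>f\<in>D. \<forall>g\<in>D. \<forall>h\<in>D. E (\<lambda>x. f x + g x) h = E f h + E g h) \<and>
     (\<forall>f\<in>D. \<forall>g\<in>D. \<forall>h\<in>D. E f (\<lambda>x. g x + h x) = E f g + E f h) \<and>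
     (\<forall>f\<in>D. \<forall>g\<in>D. \<forall>a. E (\<lambda>x. a * f x) g = a * E f g) \<and>
     (\<forall>f\<in>D. \<forall>g\<in>D. \<forall>a. E f (\<lambda>x. a * g x) = a * E f g)"

definition symmetric_form_on ::
  "('a \<Rightarrow> real) set \<Rightarrow> (('a \<Rightarrow> real) \<Rightarrow> ('a \<Rightarrow> real) \<Rightarrow> real) \<Rightarrow> bool" where
  "symmetric_form_on D E \<longleftrightarrow> (\<forall>f\<in>D. \<forall>g\<in>D. E f g = E g f)"

definition positive_form_on ::
  "('a \<Rightarrow> real) set \<Rightarrow> (('a \<Rightarrow> real) \<Rightarrow> ('a \<Rightarrow> real) \<Rightarrow> real) \<Rightarrow> bool" where
  "positive_form_on D E \<longleftrightarrow> (\<forall>f\<in>D. 0 \<le> E f f)"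

definition hilbert_space_on ::
  "'a measure \<Rightarrow> ('a \<Rightarrow> real) set \<Rightarrow> (('a \<Rightarrow> real) \<Rightarrow> ('a \<Rightarrow> real) \<Rightarrow> real) \<Rightarrow> bool" where
  "hilbert_space_on M D B \<longleftrightarrow>
     l2_subspace M D \<and> bilinear_form_on M D B \<and> symmetric_form_on D B \<and> positive_form_on D B \<and>
     (\<forall>f\<in>D. B f f = 0 \<longrightarrow> (AE x in M. f x = 0)) \<and>
     (\<forall>X. (\<forall>n::nat. X n \<in> D) \<longrightarrow>
        (\<forall>e>0. \<exists>N. \<forall>m\<ge>N. \<forall>n\<ge>N.
            sqrt (B (\<lambda>x. X m x - X n x) (\<lambda>x. X m x - X n x)) < e) \<longrightarrow>
        (\<exists>f\<in>D. (\<lambda>n. sqrt (B (\<lambda>x. X n x - f x) (\<lambda>x. X n x - f x))) \<longlonglongrightarrow> 0))"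

definition closed_form_on ::
  "'a measure \<Rightarrow> ('a \<Rightarrow> real) set \<Rightarrow> (('a \<Rightarrow> real) \<Rightarrow> ('a \<Rightarrow> real) \<Rightarrow> real) \<Rightarrow> bool" where
  "closed_form_on M D E \<longleftrightarrow> hilbert_space_on M D (\<lambda>f g. E f g + l2_inner M f g)"

definition contraction_function :: "(real \<Rightarrow> real) \<Rightarrow> bool" where
  "contraction_function C \<longleftrightarrow> C 0 = 0 \<and> (\<forall>s t. \<bar>C s - C t\<bar> \<le> \<bar>s - t\<bar>)"

definition contraction_property ::
  "('a \<Rightarrow> real) set \<Rightarrow> (('a \<Rightarrow> real) \<Rightarrow> ('a \<Rightarrow> real) \<Rightarrow> real) \<Rightarrow> bool" where
  "contraction_property D E \<longleftrightarrow>
     (\<forall>C. contraction_function C \<longrightarrow> (\<forall>f\<in>D. C \<circ> f \<in> D \<and> E (C \<circ> f) (C \<circ> f) \<le> E f f))"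

definition dirichlet_form ::
  "'a measure \<Rightarrow> ('a \<Rightarrow> real) set \<Rightarrow> (('a \<Rightarrow> real) \<Rightarrow> ('a \<Rightarrow> real) \<Rightarrow> real) \<Rightarrow> bool" where
  "dirichlet_form M D E \<longleftrightarrow>
     l2_subspace M D \<and> bilinear_form_on M D E \<and>
     l2_dense M D \<and>
     symmetric_form_on D E \<and>
     positive_form_on D E \<and>
     closed_form_on M D E \<and>
     contraction_property D E"


section \<open>The Bernoulli space\<close>

definition sign_measure :: "real \<Rightarrow> real measure" where
  "sign_measure r = point_measure {-1, 1} (\<lambda>x. ennreal (if x = 1 then r else 1 - r))"

definition bernoulli_space :: "(nat \<Rightarrow> real) \<Rightarrow> (nat \<Rightarrow> real) measure" where
  "bernoulli_space p = PiM UNIV (\<lambda>n. sign_measure (p n))"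

definition zeta :: "nat \<Rightarrow> (nat \<Rightarrow> real) \<Rightarrow> real" where
  "zeta n \<omega> = \<omega> n"

text \<open>
  The following facts confirm that the product measure is the probability measure on
  \<open>{-1,1}\<^sup>\<nat>\<close> determined by independence and the marginals of the projections.
\<close>

lemma space_sign_measure: "space (sign_measure r) = {-1, 1}"
  by (simp add: sign_measure_def space_point_measure)

lemma sets_sign_measure: "sets (sign_measure r) = Pow {-1, 1}"
  by (simp add: sign_measure_def sets_point_measure)

lemma space_bernoulli_space: "space (bernoulli_space p) = {\<omega>. \<forall>n. \<omega> n \<in> {-1, 1}}"
  by (auto simp: bernoulli_space_def space_PiM space_sign_measure PiE_def Pi_def)

lemma emeasure_sign_measure:
  "A \<subseteq> {-1, 1} \<Longrightarrow>
     emeasure (sign_measure r) A = (\<Sum>x\<in>A. ennreal (if x = 1 then r else 1 - r))"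
  unfolding sign_measure_def by (intro emeasure_point_measure_finite) auto

lemma prob_space_sign_measure:
  assumes "0 < r" "r < 1"
  shows "prob_space (sign_measure r)"
proof
  show "emeasure (sign_measure r) (space (sign_measure r)) = 1"
    using assms
    by (simp add: space_sign_measure emeasure_sign_measure ennreal_plus[symmetric] del: ennreal_plus)
qed

lemma restrict_UNIV: "restrict f UNIV = f"
  by (simp add: fun_eq_iff)

lemma prob_space_bernoulli_space:
  assumes "\<And>n. 0 < p n" "\<And>n. p n < 1"
  shows "prob_space (bernoulli_space p)"
  unfolding bernoulli_space_def using assms by (intro prob_space_PiM prob_space_sign_measure)

lemma sets_bernoulli_space:
  "sets (bernoulli_space p) =
     sigma_sets {\<omega>. \<forall>n. \<omega> n \<in> {-1, 1}}
       {{\<omega>. (\<forall>m. \<omega> m \<in> {-1, 1}) \<and> zeta n \<omega> \<in> A} | n A. A \<in> sets borel}"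
  (is "_ = sigma_sets ?\<Omega> ?G")
proof -
  have "sets (bernoulli_space p) = sigma_sets ?\<Omega>
          {{f \<in> \<Pi>\<^sub>E i\<in>UNIV. {-1, 1}. f i \<in> A} | i A. i \<in> UNIV \<and> A \<in> Pow {-1, 1::real}}"
    using space_bernoulli_space[of p]
    by (simp add: bernoulli_space_def sets_PiM_single space_sign_measure sets_sign_measure
        space_PiM)
  also have "{{f \<in> \<Pi>\<^sub>E i\<in>UNIV. {-1, 1}. f i \<in> A} | i A. i \<in> UNIV \<and> A \<in> Pow {-1, 1::real}} = ?G"
    (is "?L = _")
  proof
    show "?L \<subseteq> ?G"
    proof
      fix S assume "S \<in> ?L"
      then obtain i :: nat and A where S: "S = {f \<in> \<Pi>\<^sub>E i\<in>UNIV. {-1, 1}. f i \<in> A}" "A \<subseteq> {-1, 1}"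
        by auto
      have "finite A" using S(2) by (rule finite_subset) simp
      then have "A \<in> sets borel" by (simp add: borel_closed finite_imp_closed)
      moreover have "S = {\<omega>. (\<forall>m. \<omega> m \<in> {-1, 1}) \<and> zeta i \<omega> \<in> A}"
        by (auto simp: S zeta_def PiE_def Pi_def)
      ultimately show "S \<in> ?G" by blast
    qed
    show "?G \<subseteq> ?L"
    proof
      fix S assume "S \<in> ?G"
      then obtain i :: nat and A where S: "S = {\<omega>. (\<forall>m. \<omega> m \<in> {-1, 1}) \<and> zeta i \<omega> \<in> A}" by auto
      have "S = {f \<in> \<Pi>\<^sub>E i\<in>UNIV. {-1, 1}. f i \<in> A \<inter> {-1, 1}}"
        by (auto simp: S zeta_def PiE_def Pi_def)
      then show "S \<in> ?L" by blast
    qed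
  qed
  finally show ?thesis .
qed

lemma distr_zeta:
  assumes "\<And>n. 0 < p n" "\<And>n. p n < 1"
  shows "distr (bernoulli_space p) (sign_measure (p n)) (zeta n) = sign_measure (p n)"
proof -
  have "zeta n = (\<lambda>\<omega>. \<omega> n)" by (simp add: fun_eq_iff zeta_def)
  then show ?thesis
    unfolding bernoulli_space_def
    using distr_PiM_component[of UNIV "\<lambda>n. sign_measure (p n)" n] assms
    by (simp add: prob_space_sign_measure)
qed

lemma zeta_measurable: "zeta n \<in> bernoulli_space p \<rightarrow>\<^sub>M sign_measure (p n)"
proof -
  have "zeta n = (\<lambda>\<omega>. \<omega> n)" by (simp add: fun_eq_iff zeta_def)
  then show ?thesis unfolding bernoulli_space_def by simp
qed

lemma prob_zeta:
  assumes "\<And>n. 0 < p n" "\<And>n. p n < 1"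
  shows "measure (bernoulli_space p) {\<omega> \<in> space (bernoulli_space p). zeta n \<omega> = 1} = p n"
    and "measure (bernoulli_space p) {\<omega> \<in> space (bernoulli_space p). zeta n \<omega> = -1} = 1 - p n"
proof -
  have *: "measure (bernoulli_space p) {\<omega> \<in> space (bernoulli_space p). zeta n \<omega> = c} =
           measure (sign_measure (p n)) {c}" if "c \<in> {-1, 1}" for c
  proof -
    have "measure (sign_measure (p n)) {c} =
          measure (distr (bernoulli_space p) (sign_measure (p n)) (zeta n)) {c}"
      by (simp add: distr_zeta assms)
    also have "\<dots> = measure (bernoulli_space p) (zeta n -` {c} \<inter> space (bernoulli_space p))"
      using that by (intro measure_distr zeta_measurable) (auto simp: sets_sign_measure)
    also have "zeta n -` {c} \<inter> space (bernoulli_space p) =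
               {\<omega> \<in> space (bernoulli_space p). zeta n \<omega> = c}"
      by auto
    finally show ?thesis by simp
  qed
  show "measure (bernoulli_space p) {\<omega> \<in> space (bernoulli_space p). zeta n \<omega> = 1} = p n"
    using assms[of n]
    by (subst *) (simp_all add: measure_def emeasure_sign_measure less_imp_le)
  show "measure (bernoulli_space p) {\<omega> \<in> space (bernoulli_space p). zeta n \<omega> = -1} = 1 - p n"
    using assms[of n]
    by (subst *) (simp_all add: measure_def emeasure_sign_measure less_imp_le)
qed

lemma indep_zeta:
  assumes "\<And>n. 0 < p n" "\<And>n. p n < 1"
  shows "prob_space.indep_vars (bernoulli_space p) (\<lambda>n. sign_measure (p n)) zeta UNIV"
proof -
  interpret prob_space "bernoulli_space p" by (rule prob_space_bernoulli_space[OF assms])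
  have "distr (bernoulli_space p) (\<Pi>\<^sub>M n\<in>UNIV. sign_measure (p n)) (\<lambda>\<omega>. \<lambda>n\<in>UNIV. zeta n \<omega>) =
        bernoulli_space p"
    by (simp add: zeta_def bernoulli_space_def distr_id2 restrict_UNIV)
  also have "\<dots> = (\<Pi>\<^sub>M n\<in>UNIV. distr (bernoulli_space p) (sign_measure (p n)) (zeta n))"
    by (simp only: distr_zeta[of p, OF assms]) (simp only: bernoulli_space_def)
  finally show ?thesis
    by (subst indep_vars_iff_distr_eq_PiM') (auto intro: zeta_measurable)
qed

lemma bernoulli_space_unique:
  assumes p: "\<And>n. 0 < p n" "\<And>n. p n < 1"
    and M: "prob_space M" "sets M = sets (bernoulli_space p)"
    and indep: "prob_space.indep_vars M (\<lambda>n. sign_measure (p n)) zeta UNIV"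
    and one: "\<And>n. measure M {\<omega> \<in> space M. zeta n \<omega> = 1} = p n"
    and minus_one: "\<And>n. measure M {\<omega> \<in> space M. zeta n \<omega> = -1} = 1 - p n"
  shows "M = bernoulli_space p"
proof -
  interpret prob_space M by fact
  have meas: "zeta n \<in> M \<rightarrow>\<^sub>M sign_measure (p n)" for n
    using zeta_measurable[of n p] M(2) by (simp cong: measurable_cong_sets)
  have marg: "distr M (sign_measure (p n)) (zeta n) = sign_measure (p n)" for n
  proof (rule measure_eqI_finite[where A = "{-1, 1}"])
    fix c :: real assume c: "c \<in> {-1, 1}"
    then have "emeasure (distr M (sign_measure (p n)) (zeta n)) {c} =
        emeasure M {\<omega> \<in> space M. zeta n \<omega> = c}"
      by (subst emeasure_distr[OF meas])
         (auto simp: sets_sign_measure intro!: arg_cong[where f = "emeasure _"])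
    also have "\<dots> = ennreal (if c = 1 then p n else 1 - p n)"
      using c one[of n] minus_one[of n] by (auto simp: emeasure_eq_measure)
    also have "\<dots> = emeasure (sign_measure (p n)) {c}"
      using c by (subst emeasure_sign_measure) auto
    finally show "emeasure (distr M (sign_measure (p n)) (zeta n)) {c} =
      emeasure (sign_measure (p n)) {c}" .
  qed (auto simp: sets_sign_measure)
  have "M = distr M (\<Pi>\<^sub>M n\<in>UNIV. sign_measure (p n)) (\<lambda>\<omega>. \<lambda>n\<in>UNIV. zeta n \<omega>)"
    using M(2) by (simp add: zeta_def bernoulli_space_def distr_id2 restrict_UNIV)
  also have "\<dots> = (\<Pi>\<^sub>M n\<in>UNIV. distr M (sign_measure (p n)) (zeta n))"
    using indep by (subst (asm) indep_vars_iff_distr_eq_PiM') (auto intro: meas)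
  finally show ?thesis by (simp add: marg bernoulli_space_def)
qed


section \<open>The energy form\<close>

definition Zvar :: "(nat \<Rightarrow> real) \<Rightarrow> nat \<Rightarrow> (nat \<Rightarrow> real) \<Rightarrow> real" where
  "Zvar p n \<omega> = (let q = 1 - p n in (zeta n \<omega> + q - p n) / (2 * sqrt (p n * q)))"

definition Zprod :: "(nat \<Rightarrow> real) \<Rightarrow> nat set \<Rightarrow> (nat \<Rightarrow> real) \<Rightarrow> real" where
  "Zprod p \<sigma> \<omega> = (\<Prod>j\<in>\<sigma>. Zvar p j \<omega>)"

definition is_annihilation_operator ::
  "(nat \<Rightarrow> real) \<Rightarrow> nat \<Rightarrow> (((nat \<Rightarrow> real) \<Rightarrow> real) \<Rightarrow> ((nat \<Rightarrow> real) \<Rightarrow> real)) \<Rightarrow> bool" where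
  "is_annihilation_operator p k T \<longleftrightarrow>
     l2_bounded_linear (bernoulli_space p) T \<and>
     (\<forall>\<sigma>. finite \<sigma> \<longrightarrow>
        (AE \<omega> in bernoulli_space p. T (Zprod p \<sigma>) \<omega> = indicator \<sigma> k * Zprod p (\<sigma> - {k}) \<omega>))"

text \<open>
  The annihilation operator is unique only up to almost everywhere equality of its values,
  which is why a choice is made here instead of a definite description; the
  inner products below do not depend on it.
\<close>

definition annihilation ::
  "(nat \<Rightarrow> real) \<Rightarrow> nat \<Rightarrow> ((nat \<Rightarrow> real) \<Rightarrow> real) \<Rightarrow> ((nat \<Rightarrow> real) \<Rightarrow> real)" where
  "annihilation p k = (SOME T. is_annihilation_operator p k T)"

definition weighted_count :: "(nat \<Rightarrow> real) \<Rightarrow> nat set \<Rightarrow> real" where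
  "weighted_count w \<sigma> = (\<Sum>j\<in>\<sigma>. w j)"

definition energy_domain ::
  "(nat \<Rightarrow> real) \<Rightarrow> (nat \<Rightarrow> real) \<Rightarrow> ((nat \<Rightarrow> real) \<Rightarrow> real) set" where
  "energy_domain p w =
     {\<xi> \<in> l2 (bernoulli_space p).
        (\<lambda>\<sigma>. weighted_count w \<sigma> * \<bar>l2_inner (bernoulli_space p) (Zprod p \<sigma>) \<xi>\<bar>\<^sup>2)
          summable_on {\<sigma>. finite \<sigma>}}"

definition energy_form ::
  "(nat \<Rightarrow> real) \<Rightarrow> (nat \<Rightarrow> real) \<Rightarrow> ((nat \<Rightarrow> real) \<Rightarrow> real) \<Rightarrow> ((nat \<Rightarrow> real) \<Rightarrow> real) \<Rightarrow> real" where
  "energy_form p w \<xi> \<eta> =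
     (\<Sum>k. w k * l2_inner (bernoulli_space p) (annihilation p k \<xi>) (annihilation p k \<eta>))"

end

theory Submission
  imports Defs
begin

text \<open>The annihilation operator \<open>\<partial>\<^sub>k\<close> has an explicit description: up to null sets it is the
  difference operator
  \<open>\<Delta>\<^sub>k f (s) = sqrt (p\<^sub>k q\<^sub>k) (f (s(k := 1)) - f (s(k := -1)))\<close>.
  Both operators are bounded and act in the same way on the products \<open>Z\<^sub>\<sigma>\<close>, so they agree
  as soon as the span of the products is known to be dense in \<open>L\<^sup>2\<close>
  (\<open>annihilation_operator_unique\<close>). Hence the energy form is
  \<open>E f g = (\<Sum>k. w k \<langle>\<Delta>\<^sub>k f, \<Delta>\<^sub>k g\<rangle>)\<close>, and everything that has to be proved about it becomes
  a property of differences.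

  The contraction property is then visible pointwise: a contraction \<open>C\<close> satisfies
  \<open>\<bar>\<Delta>\<^sub>k (C \<circ> f)\<bar> \<le> \<bar>\<Delta>\<^sub>k f\<bar>\<close>. What makes this usable is that the domain, which is defined by
  the coefficients \<open>\<langle>Z\<^sub>\<sigma>, f\<rangle>\<close>, consists exactly of those \<open>f\<close> for which
  \<open>(\<Sum>k. w k \<parallel>\<Delta>\<^sub>k f\<parallel>\<^sup>2)\<close> converges (\<open>energy_domain_iff\<close>): by Parseval's identity
  \<open>\<parallel>\<Delta>\<^sub>k f\<parallel>\<^sup>2\<close> is the sum of \<open>\<langle>Z\<^sub>\<sigma>, f\<rangle>\<^sup>2\<close> over the finite sets \<open>\<sigma>\<close> that contain \<open>k\<close>, and
  summing over \<open>k\<close> first or over \<open>\<sigma>\<close> first gives the same.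

  Closedness rests on Fatou's lemma. A sequence that is Cauchy for the norm of the form is Cauchy in
  \<open>L\<^sup>1\<close> and thus has an almost everywhere convergent subsequence. Almost everywhere convergence
  passes to differences, because fixing the value of one coordinate preserves null sets; so the
  form is lower semicontinuous under it (\<open>energy_lower_semicontinuous\<close>), which places the
  limit in the domain and gives convergence in the norm of the form.

  The independence of the coordinates enters only through the resampling identity
  \<open>\<integral> g(s) = \<integral> p\<^sub>k g(s(k := 1)) + q\<^sub>k g(s(k := -1))\<close>. It shows that \<open>\<Delta>\<^sub>k\<close> is a contraction
  of \<open>L\<^sup>2\<close> and that \<open>\<langle>Z\<^bsub>insert k \<sigma>\<^esub>, f\<rangle> = \<langle>Z\<^sub>\<sigma>, \<Delta>\<^sub>k f\<rangle>\<close> for \<open>k \<notin> \<sigma>\<close>,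
  from which the orthonormality of the products follows. Their completeness follows from a Dynkin system argument, starting with cylinder sets,
  whose indicators are polynomials in the \<open>Z\<^sub>j\<close>.\<close>

section \<open>Square integrable functions\<close>

lemma l2_measurable: "f \<in> l2 M \<Longrightarrow> f \<in> borel_measurable M"
  by (simp add: l2_def)

lemma l2_square_integrable: "f \<in> l2 M \<Longrightarrow> integrable M (\<lambda>x. (f x)\<^sup>2)"
  by (simp add: l2_def)

lemma two_mult_le: "2 * \<bar>a * b\<bar> \<le> a\<^sup>2 + (b::real)\<^sup>2"
  using zero_le_power2[of "\<bar>a\<bar> - \<bar>b\<bar>"] by (simp add: power2_diff abs_mult)

lemma l2_mult_integrable:
  assumes "f \<in> l2 M" "g \<in> l2 M"
  shows "integrable M (\<lambda>x. f x * g x)"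
proof (rule Bochner_Integration.integrable_bound)
  show "integrable M (\<lambda>x. (f x)\<^sup>2 + (g x)\<^sup>2)"
    using assms by (simp add: l2_square_integrable)
  show "(\<lambda>x. f x * g x) \<in> borel_measurable M"
    using assms by (intro borel_measurable_times l2_measurable)
  have "\<bar>a * b\<bar> \<le> a\<^sup>2 + b\<^sup>2" for a b :: real
    using two_mult_le[of a b] by (smt (verit) abs_ge_zero)
  then show "AE x in M. norm (f x * g x) \<le> norm ((f x)\<^sup>2 + (g x)\<^sup>2)"
    by (auto simp: abs_of_nonneg)
qed

lemma square_add_le: "(a + b)\<^sup>2 \<le> 2 * a\<^sup>2 + 2 * (b::real)\<^sup>2"
  using zero_le_power2[of "a - b"] by (simp add: power2_sum power2_diff)

lemma l2_dominated:
  assumes "f \<in> borel_measurable M" "integrable M h" "\<And>x. x \<in> space M \<Longrightarrow> (f x)\<^sup>2 \<le> h x"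
  shows "f \<in> l2 M"
proof -
  have "integrable M (\<lambda>x. (f x)\<^sup>2)"
  proof (rule Bochner_Integration.integrable_bound[OF assms(2)])
    show "AE x in M. norm ((f x)\<^sup>2) \<le> norm (h x)"
      using assms(3) by (intro AE_I2) (auto intro: order_trans[OF _ abs_ge_self])
  qed (use assms(1) in measurable)
  then show ?thesis using assms(1) by (simp add: l2_def)
qed

lemma l2_zero: "(\<lambda>x. 0) \<in> l2 M"
  by (simp add: l2_def)

lemma l2_scale: "f \<in> l2 M \<Longrightarrow> (\<lambda>x. a * f x) \<in> l2 M"
  by (auto simp: l2_def power_mult_distrib)

lemma l2_add:
  assumes "f \<in> l2 M" "g \<in> l2 M"
  shows "(\<lambda>x. f x + g x) \<in> l2 M"
  by (rule l2_dominated[where h = "\<lambda>x. 2 * (f x)\<^sup>2 + 2 * (g x)\<^sup>2"])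
     (use assms in \<open>auto simp: l2_square_integrable square_add_le
        intro: borel_measurable_add l2_measurable\<close>)

lemma l2_diff:
  assumes "f \<in> l2 M" "g \<in> l2 M"
  shows "(\<lambda>x. f x - g x) \<in> l2 M"
  using l2_add[OF assms(1) l2_scale[OF assms(2), of "- 1"]] by simp

lemma l2_sum:
  assumes "\<And>i. i \<in> S \<Longrightarrow> f i \<in> l2 M"
  shows "(\<lambda>x. \<Sum>i\<in>S. f i x) \<in> l2 M"
  using assms
  by (induction S rule: infinite_finite_induct) (auto simp: l2_zero intro: l2_add)

lemma l2_inner_commute: "l2_inner M f g = l2_inner M g f"
  by (simp add: l2_inner_def mult.commute)

lemma l2_inner_self: "l2_inner M f f = (\<integral>x. (f x)\<^sup>2 \<partial>M)"
  by (simp add: l2_inner_def power2_eq_square)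

lemma l2_inner_self_nonneg: "0 \<le> l2_inner M f f"
  by (simp add: l2_inner_self)

lemma l2_inner_add_left:
  assumes "f \<in> l2 M" "g \<in> l2 M" "h \<in> l2 M"
  shows "l2_inner M (\<lambda>x. f x + g x) h = l2_inner M f h + l2_inner M g h"
  using assms by (simp add: l2_inner_def distrib_right l2_mult_integrable)

lemma l2_inner_scale_left: "l2_inner M (\<lambda>x. a * f x) g = a * l2_inner M f g"
  by (simp add: l2_inner_def mult.assoc)

lemma l2_inner_sum_left:
  assumes "\<And>i. i \<in> S \<Longrightarrow> f i \<in> l2 M" "h \<in> l2 M"
  shows "l2_inner M (\<lambda>x. \<Sum>i\<in>S. f i x) h = (\<Sum>i\<in>S. l2_inner M (f i) h)"
  using assms by (simp add: l2_inner_def sum_distrib_right l2_mult_integrable)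

lemma l2_inner_cong_AE:
  assumes "f \<in> l2 M" "f' \<in> l2 M" "g \<in> l2 M" "g' \<in> l2 M"
    and "AE x in M. f x = f' x" "AE x in M. g x = g' x"
  shows "l2_inner M f g = l2_inner M f' g'"
  unfolding l2_inner_def
proof (rule integral_cong_AE)
  show "AE x in M. f x * g x = f' x * g' x"
    using assms(5,6) by eventually_elim simp
qed (use assms in \<open>auto intro: borel_measurable_times l2_measurable\<close>)

lemma l2_inner_mono:
  assumes "f \<in> l2 M" "g \<in> l2 M" "\<And>x. x \<in> space M \<Longrightarrow> \<bar>f x\<bar> \<le> \<bar>g x\<bar>"
  shows "l2_inner M f f \<le> l2_inner M g g"
  unfolding l2_inner_self
  by (intro integral_mono) (use assms in \<open>auto simp: l2_square_integrable abs_le_square_iff\<close>)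

lemma l2_inner_add_self_le:
  assumes "f \<in> l2 M" "g \<in> l2 M"
  shows "l2_inner M (\<lambda>x. f x + g x) (\<lambda>x. f x + g x) \<le> 2 * l2_inner M f f + 2 * l2_inner M g g"
proof -
  have "l2_inner M (\<lambda>x. f x + g x) (\<lambda>x. f x + g x) \<le> (\<integral>x. 2 * (f x)\<^sup>2 + 2 * (g x)\<^sup>2 \<partial>M)"
    unfolding l2_inner_self
    by (intro integral_mono)
       (use assms in \<open>auto simp: l2_square_integrable l2_add square_add_le\<close>)
  also have "\<dots> = 2 * l2_inner M f f + 2 * l2_inner M g g"
    unfolding l2_inner_self using assms by (simp add: l2_square_integrable)
  finally show ?thesis .
qed

lemma l2_inner_scale_self: "l2_inner M (\<lambda>x. a * f x) (\<lambda>x. a * f x) = a\<^sup>2 * l2_inner M f f"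
  by (simp add: l2_inner_self power_mult_distrib)

lemma two_l2_inner_le:
  assumes "f \<in> l2 M" "g \<in> l2 M"
  shows "2 * \<bar>l2_inner M f g\<bar> \<le> l2_inner M f f + l2_inner M g g"
proof -
  have "2 * \<bar>l2_inner M f g\<bar> \<le> 2 * (\<integral>x. \<bar>f x * g x\<bar> \<partial>M)"
    unfolding l2_inner_def by (intro mult_left_mono integral_abs_bound) simp
  also have "\<dots> = (\<integral>x. 2 * \<bar>f x * g x\<bar> \<partial>M)"
    by simp
  also have "\<dots> \<le> (\<integral>x. (f x)\<^sup>2 + (g x)\<^sup>2 \<partial>M)"
    by (intro integral_mono)
       (use assms in \<open>auto simp: l2_square_integrable two_mult_le
          intro!: integrable_mult_right integrable_abs l2_mult_integrable\<close>)
  also have "\<dots> = l2_inner M f f + l2_inner M g g"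
    unfolding l2_inner_self using assms by (simp add: l2_square_integrable)
  finally show ?thesis .
qed

lemma l2_inner_self_eq_0:
  assumes "f \<in> l2 M" "l2_inner M f f = 0"
  shows "AE x in M. f x = 0"
proof -
  have "AE x in M. (f x)\<^sup>2 = 0"
    using assms integral_nonneg_eq_0_iff_AE[OF l2_square_integrable[OF assms(1)]]
    by (simp add: l2_inner_self)
  then show ?thesis by simp
qed


lemma l2_inner_diff_self:
  assumes "f \<in> l2 N" "g \<in> l2 N"
  shows "l2_inner N (\<lambda>x. f x - g x) (\<lambda>x. f x - g x) =
    l2_inner N f f - 2 * l2_inner N g f + l2_inner N g g"
proof -
  have "l2_inner N (\<lambda>x. f x - g x) (\<lambda>x. f x - g x) =
      (\<integral>x. f x * f x - 2 * (g x * f x) + g x * g x \<partial>N)"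
    unfolding l2_inner_def by (simp add: algebra_simps)
  also have "\<dots> = l2_inner N f f - 2 * l2_inner N g f + l2_inner N g g"
    unfolding l2_inner_def using assms
    by (simp add: l2_mult_integrable)
  finally show ?thesis .
qed

text \<open>The variance of \<open>\<bar>h\<bar>\<close> is nonnegative.\<close>

lemma (in prob_space) l1_le_l2:
  assumes h: "h \<in> l2 M"
  shows "(\<integral>s. \<bar>h s\<bar> \<partial>M) \<le> sqrt (l2_inner M h h)"
proof (rule real_le_rsqrt)
  have one: "(\<lambda>s. 1) \<in> l2 M" by (simp add: l2_def)
  have int: "integrable M (\<lambda>s. \<bar>h s\<bar>)"
    using l2_mult_integrable[OF h one] by simp
  have "0 \<le> variance (\<lambda>s. \<bar>h s\<bar>)" by (rule variance_positive)
  also have "\<dots> = l2_inner M h h - (\<integral>s. \<bar>h s\<bar> \<partial>M)\<^sup>2"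
    using int h by (simp add: variance_eq l2_square_integrable l2_inner_self)
  finally show "(\<integral>s. \<bar>h s\<bar> \<partial>M)\<^sup>2 \<le> l2_inner M h h" by simp
qed

lemma bilinear_form_on_add:
  assumes "bilinear_form_on N V A" "bilinear_form_on N V B"
  shows "bilinear_form_on N V (\<lambda>f g. A f g + B f g)"
  unfolding bilinear_form_on_def
proof (intro conjI ballI allI impI)
  fix f f' g g'
  assume "f \<in> V" "f' \<in> V" "g \<in> V" "g' \<in> V" "AE x in N. f x = f' x" "AE x in N. g x = g' x"
  note arg = this
  have "A f g = A f' g'"
    by (rule assms(1)[unfolded bilinear_form_on_def, THEN conjunct1, rule_format, OF arg])
  moreover have "B f g = B f' g'"
    by (rule assms(2)[unfolded bilinear_form_on_def, THEN conjunct1, rule_format, OF arg])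
  ultimately show "A f g + B f g = A f' g' + B f' g'" by simp
qed (use assms[unfolded bilinear_form_on_def, THEN conjunct2] in
    \<open>simp_all add: distrib_left\<close>)


section \<open>Resampling one coordinate\<close>

locale bernoulli =
  fixes p :: "nat \<Rightarrow> real"
  assumes p_pos: "\<And>n. 0 < p n" and p_less_1: "\<And>n. p n < 1"
begin

abbreviation "M \<equiv> bernoulli_space p"

sublocale prob_space M
  by (rule prob_space_bernoulli_space) (rule p_pos p_less_1)+

lemma update_measurable:
  "(\<lambda>(x, s). s(k := x)) \<in> sign_measure (p k) \<Otimes>\<^sub>M M \<rightarrow>\<^sub>M M"
proof -
  have "(\<lambda>(x, s). (s::nat \<Rightarrow> real)(k := x)) \<in>
     sign_measure (p k) \<Otimes>\<^sub>M Pi\<^sub>M UNIV (\<lambda>n. sign_measure (p n)) \<rightarrow>\<^sub>M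
     Pi\<^sub>M (insert k UNIV) (\<lambda>n. sign_measure (p n))"
    by measurable
  then show ?thesis by (simp add: bernoulli_space_def insert_absorb)
qed

lemma update_measurable_section:
  assumes "x \<in> {-1, 1}"
  shows "(\<lambda>s. s(k := x)) \<in> M \<rightarrow>\<^sub>M M"
  using measurable_compose[OF measurable_Pair1'[of x] update_measurable[of k]] assms
  by (simp add: space_sign_measure)

text \<open>The product measure over \<open>UNIV\<close> is also the product over \<open>insert k UNIV\<close>, so overwriting
  coordinate \<open>k\<close> by an independent sample of the same law does not change it.\<close>

lemma distr_update:
  "distr (sign_measure (p k) \<Otimes>\<^sub>M M) M (\<lambda>(x, s). s(k := x)) = M"
  using distr_pair_PiM_eq_PiM[of UNIV "\<lambda>n. sign_measure (p n)" k]
  by (simp add: prob_space_sign_measure p_pos p_less_1 bernoulli_space_def insert_absorb)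

lemma nn_integral_resample:
  assumes g [measurable]: "g \<in> borel_measurable M"
  shows "(\<integral>\<^sup>+s. g s \<partial>M) =
     p k * (\<integral>\<^sup>+s. g (s(k := 1)) \<partial>M) + (1 - p k) * (\<integral>\<^sup>+s. g (s(k := -1)) \<partial>M)"
proof -
  note update_measurable [measurable]
  have "(\<integral>\<^sup>+s. g s \<partial>M) =
      (\<integral>\<^sup>+z. g (case z of (x, s) \<Rightarrow> s(k := x)) \<partial>(sign_measure (p k) \<Otimes>\<^sub>M M))"
    by (subst distr_update[of k, symmetric]) (rule nn_integral_distr; simp add: update_measurable)
  also have "\<dots> = (\<integral>\<^sup>+x. \<integral>\<^sup>+s. g (s(k := x)) \<partial>M \<partial>sign_measure (p k))"
    by (subst nn_integral_fst[symmetric]) (auto intro!: measurable_compose[OF update_measurable])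
  also have "\<dots> = p k * (\<integral>\<^sup>+s. g (s(k := 1)) \<partial>M) + (1 - p k) * (\<integral>\<^sup>+s. g (s(k := -1)) \<partial>M)"
    unfolding sign_measure_def
    by (subst nn_integral_point_measure_finite) (auto simp: mult.commute add.commute)
  finally show ?thesis .
qed

text \<open>Both values of a coordinate have positive probability; so fixing one coordinate
  does not turn a null set into a set of positive measure.\<close>

lemma AE_update:
  assumes "AE s in M. P s" "x \<in> {-1, 1}"
  shows "AE s in M. P (s(k := x))"
proof -
  obtain N where N: "N \<in> sets M" "emeasure M N = 0" "{s \<in> space M. \<not> P s} \<subseteq> N"
    using assms(1) by (auto elim!: AE_E)
  have "0 = (\<integral>\<^sup>+s. indicator N s \<partial>M)"
    using N by simp
  also have "\<dots> = p k * (\<integral>\<^sup>+s. indicator N (s(k := 1)) \<partial>M) +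
      (1 - p k) * (\<integral>\<^sup>+s. indicator N (s(k := -1)) \<partial>M)"
    using N by (intro nn_integral_resample) auto
  finally have "(\<integral>\<^sup>+s. indicator N (s(k := x)) \<partial>M) = 0"
    using assms(2) p_pos[of k] p_less_1[of k] by (auto simp: ennreal_eq_0_iff add_eq_0_iff_both_eq_0)
  moreover have "(\<lambda>s. indicator N (s(k := x)) :: ennreal) \<in> borel_measurable M"
    using N(1) by (intro measurable_compose[OF update_measurable_section[OF assms(2)]]) auto
  ultimately have "AE s in M. indicator N (s(k := x)) = (0::ennreal)"
    by (simp add: nn_integral_0_iff_AE)
  moreover have "AE s in M. s(k := x) \<in> space M"
    using measurable_space[OF update_measurable_section[OF assms(2)]] by simp
  ultimately show ?thesis
    by eventually_elim (use N(3) in \<open>auto simp: indicator_def split: if_splits\<close>)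
qed

text \<open>The value \<open>x\<close> has positive probability, so the section of an integrable function is bounded in
  \<open>L\<^sup>1\<close> by a multiple of the whole; this holds for each of the two sections, not just for
  almost every one.\<close>

lemma integrable_update:
  fixes g :: "(nat \<Rightarrow> real) \<Rightarrow> real"
  assumes "integrable M g" "x \<in> {-1, 1}"
  shows "integrable M (\<lambda>s. g (s(k := x)))"
proof (rule integrableI_bounded)
  show "(\<lambda>s. g (s(k := x))) \<in> borel_measurable M"
    using assms by (intro measurable_compose[OF update_measurable_section]) auto
  have "(\<integral>\<^sup>+s. norm (g s) \<partial>M) < \<infinity>"
    using assms(1) by (simp add: integrable_iff_bounded)
  also have "(\<integral>\<^sup>+s. norm (g s) \<partial>M) = p k * (\<integral>\<^sup>+s. norm (g (s(k := 1))) \<partial>M) +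
      (1 - p k) * (\<integral>\<^sup>+s. norm (g (s(k := -1))) \<partial>M)"
    using assms(1) by (intro nn_integral_resample) auto
  finally show "(\<integral>\<^sup>+s. norm (g (s(k := x))) \<partial>M) < \<infinity>"
    using assms(2) p_pos[of k] p_less_1[of k]
    by (auto simp: ennreal_mult_less_top)
qed

lemma integral_resample:
  fixes g :: "(nat \<Rightarrow> real) \<Rightarrow> real"
  assumes g: "integrable M g"
  shows "(\<integral>s. g s \<partial>M) = (\<integral>s. p k * g (s(k := 1)) + (1 - p k) * g (s(k := -1)) \<partial>M)"
proof -
  interpret sign: prob_space "sign_measure (p k)"
    by (rule prob_space_sign_measure[OF p_pos p_less_1])
  interpret pair: pair_prob_space "sign_measure (p k)" M ..
  have int: "integrable (sign_measure (p k) \<Otimes>\<^sub>M M) (\<lambda>z. g (case z of (x, s) \<Rightarrow> s(k := x)))"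
    using g by (subst integrable_distr_eq[symmetric, OF update_measurable]) (auto simp: distr_update)
  have "(\<integral>s. g s \<partial>M) =
      (\<integral>z. g (case z of (x, s) \<Rightarrow> s(k := x)) \<partial>(sign_measure (p k) \<Otimes>\<^sub>M M))"
    using g by (subst distr_update[of k, symmetric]) (rule integral_distr; simp add: update_measurable)
  also have "\<dots> = (\<integral>x. \<integral>s. g (s(k := x)) \<partial>M \<partial>sign_measure (p k))"
    by (subst pair.integral_fst'[OF int, symmetric]) simp
  also have "\<dots> = p k * (\<integral>s. g (s(k := 1)) \<partial>M) + (1 - p k) * (\<integral>s. g (s(k := -1)) \<partial>M)"
    unfolding sign_measure_def using p_pos[of k] p_less_1[of k]
    by (subst lebesgue_integral_point_measure_finite) auto
  finally show ?thesis
    using integrable_update[OF g] by simp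
qed

lemma l2_update:
  assumes "f \<in> l2 M" "x \<in> {-1, 1}"
  shows "(\<lambda>s. f (s(k := x))) \<in> l2 M"
  using assms integrable_update[of "\<lambda>s. (f s)\<^sup>2" x k]
    measurable_compose[OF update_measurable_section[of x k]]
  by (auto simp: l2_def)


section \<open>The difference operator and its adjoint\<close>

text \<open>The factor is the reciprocal of the difference of \<open>Zvar p k\<close> between its two values, which makes
  the operator send \<open>Zvar p k\<close> to 1.\<close>

definition difference :: "nat \<Rightarrow> ((nat \<Rightarrow> real) \<Rightarrow> real) \<Rightarrow> (nat \<Rightarrow> real) \<Rightarrow> real" where
  "difference k f s = sqrt (p k * (1 - p k)) * (f (s(k := 1)) - f (s(k := -1)))"

lemma difference_add: "difference k (\<lambda>s. f s + g s) s = difference k f s + difference k g s"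
  by (simp add: difference_def algebra_simps)

lemma difference_scale: "difference k (\<lambda>s. a * f s) s = a * difference k f s"
  by (simp add: difference_def algebra_simps)

lemma difference_diff: "difference k (\<lambda>s. f s - g s) s = difference k f s - difference k g s"
  by (simp add: difference_def algebra_simps)

lemma difference_add_fun:
  "difference k (\<lambda>s. f s + g s) = (\<lambda>s. difference k f s + difference k g s)"
  by (simp add: difference_add fun_eq_iff)

lemma difference_scale_fun: "difference k (\<lambda>s. a * f s) = (\<lambda>s. a * difference k f s)"
  by (simp add: difference_scale fun_eq_iff)

lemma difference_l2:
  assumes "f \<in> l2 M"
  shows "difference k f \<in> l2 M"
  using assms by (auto simp: difference_def[abs_def] intro!: l2_scale l2_diff l2_update)

lemma difference_AE_cong:
  assumes "AE s in M. f s = g s"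
  shows "AE s in M. difference k f s = difference k g s"
proof -
  have "AE s in M. f (s(k := 1)) = g (s(k := 1))" "AE s in M. f (s(k := -1)) = g (s(k := -1))"
    using AE_update[OF assms] by simp_all
  then show ?thesis
    by eventually_elim (simp add: difference_def)
qed

text \<open>On each fibre \<open>{s(k := 1), s(k := -1)}\<close> the square of the difference is a variance, namely that of
  \<open>f\<close> under the weights \<open>p k\<close> and \<open>1 - p k\<close>, and a variance is at most the second moment.\<close>

lemma difference_norm_le:
  assumes f: "f \<in> l2 M"
  shows "l2_inner M (difference k f) (difference k f) \<le> l2_inner M f f"
proof -
  have pq: "p k * (1 - p k) * (a - b)\<^sup>2 \<le> p k * a\<^sup>2 + (1 - p k) * b\<^sup>2" for a b
  proof -
    have "p k * a\<^sup>2 + (1 - p k) * b\<^sup>2 - p k * (1 - p k) * (a - b)\<^sup>2 = (p k * a + (1 - p k) * b)\<^sup>2"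
      by (simp add: power2_eq_square algebra_simps)
    then show ?thesis by (smt (verit) zero_le_power2)
  qed
  have "l2_inner M (difference k f) (difference k f) =
      (\<integral>s. p k * (1 - p k) * (f (s(k := 1)) - f (s(k := -1)))\<^sup>2 \<partial>M)"
    using p_pos[of k] p_less_1[of k]
    by (simp add: l2_inner_self difference_def power_mult_distrib)
  also have "\<dots> \<le> (\<integral>s. p k * (f (s(k := 1)))\<^sup>2 + (1 - p k) * (f (s(k := -1)))\<^sup>2 \<partial>M)"
    by (intro integral_mono pq)
       (auto intro!: integrable_mult_right Bochner_Integration.integrable_add l2_square_integrable l2_diff l2_update f)
  also have "\<dots> = l2_inner M f f"
    unfolding l2_inner_self using f
    by (intro integral_resample[symmetric] l2_square_integrable)
  finally show ?thesis .
qed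

lemma Zvar_update: "j \<noteq> k \<Longrightarrow> Zvar p j (s(k := x)) = Zvar p j s"
  by (simp add: Zvar_def zeta_def)

lemma Zprod_update: "k \<notin> \<sigma> \<Longrightarrow> Zprod p \<sigma> (s(k := x)) = Zprod p \<sigma> s"
  unfolding Zprod_def by (intro prod.cong refl Zvar_update) auto

lemma Zprod_insert:
  "finite \<sigma> \<Longrightarrow> k \<notin> \<sigma> \<Longrightarrow> Zprod p (insert k \<sigma>) s = Zvar p k s * Zprod p \<sigma> s"
  by (simp add: Zprod_def)

lemma sqrt_pq_pos: "0 < sqrt (p k * (1 - p k))"
  using p_pos[of k] p_less_1[of k] by simp

lemma Zvar_one: "p k * Zvar p k (s(k := 1)) = sqrt (p k * (1 - p k))"
proof -
  have "sqrt (p k * (1 - p k)) * sqrt (p k * (1 - p k)) = p k * (1 - p k)"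
    using p_pos[of k] p_less_1[of k] by simp
  then show ?thesis
    using sqrt_pq_pos[of k] by (simp add: Zvar_def zeta_def Let_def divide_simps) (simp add: algebra_simps)
qed

lemma Zvar_minus_one: "(1 - p k) * Zvar p k (s(k := -1)) = - sqrt (p k * (1 - p k))"
proof -
  have "sqrt (p k * (1 - p k)) * sqrt (p k * (1 - p k)) = p k * (1 - p k)"
    using p_pos[of k] p_less_1[of k] by simp
  then show ?thesis
    using sqrt_pq_pos[of k] by (simp add: Zvar_def zeta_def Let_def divide_simps)
qed

lemma difference_Zvar: "difference k (Zvar p k) s = 1"
proof -
  have "Zvar p k (s(k := 1)) - Zvar p k (s(k := -1)) = 1 / sqrt (p k * (1 - p k))"
    unfolding Zvar_def zeta_def Let_def diff_divide_distrib[symmetric] by simp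
  then show ?thesis
    using p_pos[of k] p_less_1[of k] by (simp add: difference_def)
qed

lemma difference_Zprod:
  assumes "finite \<sigma>"
  shows "difference k (Zprod p \<sigma>) s = indicator \<sigma> k * Zprod p (\<sigma> - {k}) s"
proof (cases "k \<in> \<sigma>")
  case True
  then obtain \<tau> where \<tau>: "\<sigma> = insert k \<tau>" "k \<notin> \<tau>" by (meson mk_disjoint_insert)
  have "difference k (Zprod p \<sigma>) s = difference k (Zvar p k) s * Zprod p \<tau> s"
    using assms \<tau> by (simp add: difference_def Zprod_insert Zprod_update algebra_simps)
  then show ?thesis using \<tau> by (simp add: difference_Zvar)
qed (simp add: difference_def Zprod_update)

lemma Zvar_measurable [measurable]: "Zvar p j \<in> borel_measurable M"
proof -
  have "(\<lambda>x::real. (x + (1 - p j) - p j) / (2 * sqrt (p j * (1 - p j)))) \<in>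
      borel_measurable (sign_measure (p j))"
    by (simp add: sign_measure_def)
  from measurable_compose[OF zeta_measurable[of j p] this] show ?thesis
    by (simp add: Zvar_def[abs_def] Let_def)
qed

lemma Zprod_measurable [measurable]: "Zprod p \<sigma> \<in> borel_measurable M"
  unfolding Zprod_def[abs_def] by measurable

lemma Zvar_bound:
  assumes "s \<in> space M"
  shows "\<bar>Zvar p j s\<bar> \<le> 1 / sqrt (p j * (1 - p j))"
proof -
  have "s j \<in> {-1, 1}" using assms by (auto simp: space_bernoulli_space)
  then have "\<bar>zeta j s + (1 - p j) - p j\<bar> \<le> 2"
    using p_pos[of j] p_less_1[of j] by (auto simp: zeta_def)
  then show ?thesis
    using sqrt_pq_pos[of j] by (simp add: Zvar_def Let_def abs_divide divide_simps)
qed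

lemma Zprod_l2: "Zprod p \<sigma> \<in> l2 M"
proof (rule l2_dominated)
  fix s assume "s \<in> space M"
  then have "\<bar>Zprod p \<sigma> s\<bar> \<le> (\<Prod>j\<in>\<sigma>. 1 / sqrt (p j * (1 - p j)))"
    unfolding Zprod_def abs_prod by (intro prod_mono) (auto intro: Zvar_bound)
  then show "(Zprod p \<sigma> s)\<^sup>2 \<le> (\<Prod>j\<in>\<sigma>. 1 / sqrt (p j * (1 - p j)))\<^sup>2"
    using power_mono[of "\<bar>Zprod p \<sigma> s\<bar>" _ 2] by simp
qed auto

text \<open>Resampling coordinate \<open>k\<close> averages \<open>Zvar p k * f\<close> over the two values of that coordinate, and
  this average is the difference of \<open>f\<close>: both \<open>p k * Zvar p k\<close> at 1 and
  \<open>- (1 - p k) * Zvar p k\<close> at -1 equal \<open>sqrt (p k * (1 - p k))\<close>.\<close>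

lemma inner_Zprod_insert:
  assumes "finite \<sigma>" "k \<notin> \<sigma>" "f \<in> l2 M"
  shows "l2_inner M (Zprod p (insert k \<sigma>)) f = l2_inner M (Zprod p \<sigma>) (difference k f)"
proof -
  have "l2_inner M (Zprod p (insert k \<sigma>)) f =
     (\<integral>s. p k * (Zprod p (insert k \<sigma>) (s(k := 1)) * f (s(k := 1))) +
       (1 - p k) * (Zprod p (insert k \<sigma>) (s(k := -1)) * f (s(k := -1))) \<partial>M)"
    unfolding l2_inner_def
    by (intro integral_resample l2_mult_integrable Zprod_l2 assms)
  also have "\<dots> = (\<integral>s. Zprod p \<sigma> s * difference k f s \<partial>M)"
  proof (rule Bochner_Integration.integral_cong[OF refl])
    fix s
    have "p k * (Zprod p (insert k \<sigma>) (s(k := 1)) * f (s(k := 1))) +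
       (1 - p k) * (Zprod p (insert k \<sigma>) (s(k := -1)) * f (s(k := -1))) =
       (p k * Zvar p k (s(k := 1))) * (Zprod p \<sigma> s * f (s(k := 1))) +
       ((1 - p k) * Zvar p k (s(k := -1))) * (Zprod p \<sigma> s * f (s(k := -1)))"
      using assms by (simp add: Zprod_insert Zprod_update)
    also have "\<dots> = Zprod p \<sigma> s * difference k f s"
      unfolding Zvar_one Zvar_minus_one by (simp add: difference_def algebra_simps)
    finally show "p k * (Zprod p (insert k \<sigma>) (s(k := 1)) * f (s(k := 1))) +
       (1 - p k) * (Zprod p (insert k \<sigma>) (s(k := -1)) * f (s(k := -1))) =
       Zprod p \<sigma> s * difference k f s" .
  qed
  finally show ?thesis by (simp add: l2_inner_def)
qed

text \<open>For \<open>k \<in> \<sigma>\<close> the adjoint relation moves one more difference to the right, and the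
  difference operator is nilpotent since its values do not depend on coordinate \<open>k\<close>.\<close>

lemma inner_Zprod_difference:
  assumes "finite \<sigma>" "f \<in> l2 M"
  shows "l2_inner M (Zprod p \<sigma>) (difference k f) =
    (if k \<in> \<sigma> then 0 else l2_inner M (Zprod p (insert k \<sigma>)) f)"
proof (cases "k \<in> \<sigma>")
  case True
  then obtain \<tau> where \<tau>: "\<sigma> = insert k \<tau>" "k \<notin> \<tau>" by (meson mk_disjoint_insert)
  have "difference k (difference k f) = (\<lambda>s. 0)"
    by (simp add: fun_eq_iff difference_def)
  then show ?thesis
    using assms \<tau> inner_Zprod_insert[of \<tau> k "difference k f"]
    by (simp add: difference_l2 l2_inner_def)
qed (use assms in \<open>simp add: inner_Zprod_insert\<close>)

text \<open>Moving the factors of the left product to the right one by one removes the same elements from the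
  set on the right, and gives 0 as soon as one of them is missing there.\<close>

lemma Zprod_orthonormal:
  assumes "finite \<sigma>" "finite \<tau>"
  shows "l2_inner M (Zprod p \<sigma>) (Zprod p \<tau>) = (if \<sigma> = \<tau> then 1 else 0)"
  using assms
proof (induction \<sigma> arbitrary: \<tau> rule: finite_induct)
  case empty
  show ?case
  proof (cases "\<tau> = {}")
    case True
    then show ?thesis by (simp add: l2_inner_def Zprod_def prob_space)
  next
    case False
    then obtain k \<rho> where \<tau>: "\<tau> = insert k \<rho>" "k \<notin> \<rho>" by (meson mk_disjoint_insert ex_in_conv)
    have "difference k (Zprod p {}) = (\<lambda>s. 0)"
      by (simp add: fun_eq_iff difference_Zprod)
    then have "l2_inner M (Zprod p \<tau>) (Zprod p {}) = 0"
      using \<tau> empty inner_Zprod_insert[of \<rho> k "Zprod p {}"]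
      by (simp add: Zprod_l2) (simp add: l2_inner_def)
    then show ?thesis using False by (simp add: l2_inner_commute)
  qed
next
  case (insert k \<sigma>)
  have "difference k (Zprod p \<tau>) = (\<lambda>s. indicator \<tau> k * Zprod p (\<tau> - {k}) s)"
    using insert by (simp add: fun_eq_iff difference_Zprod)
  then have "l2_inner M (Zprod p (insert k \<sigma>)) (Zprod p \<tau>) =
      l2_inner M (Zprod p \<sigma>) (\<lambda>s. indicator \<tau> k * Zprod p (\<tau> - {k}) s)"
    using insert by (simp add: inner_Zprod_insert Zprod_l2)
  also have "\<dots> = indicator \<tau> k * l2_inner M (Zprod p \<sigma>) (Zprod p (\<tau> - {k}))"
    by (simp add: l2_inner_commute[of M "Zprod p \<sigma>"] l2_inner_scale_left)
  also have "\<dots> = (if insert k \<sigma> = \<tau> then 1 else 0)"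
    using insert by (auto simp: indicator_def insert_absorb)
  finally show ?case .
qed


section \<open>Completeness of the system of products\<close>

definition Zsum :: "nat set set \<Rightarrow> (nat set \<Rightarrow> real) \<Rightarrow> (nat \<Rightarrow> real) \<Rightarrow> real" where
  "Zsum S c s = (\<Sum>\<sigma>\<in>S. c \<sigma> * Zprod p \<sigma> s)"

definition Zspan :: "((nat \<Rightarrow> real) \<Rightarrow> real) set" where
  "Zspan = {Zsum S c | S c. finite S \<and> S \<subseteq> Collect finite}"

definition Zclosure :: "((nat \<Rightarrow> real) \<Rightarrow> real) set" where
  "Zclosure = {f \<in> l2 M. \<forall>e>0. \<exists>g\<in>Zspan. l2_inner M (\<lambda>s. f s - g s) (\<lambda>s. f s - g s) < e}"

lemma Zsum_l2: "Zsum S c \<in> l2 M"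
  unfolding Zsum_def[abs_def] by (intro l2_sum l2_scale Zprod_l2)

lemma Zspan_l2: "g \<in> Zspan \<Longrightarrow> g \<in> l2 M"
  by (auto simp: Zspan_def Zsum_l2)

lemma Zspan_add:
  assumes "f \<in> Zspan" "g \<in> Zspan"
  shows "(\<lambda>s. f s + g s) \<in> Zspan"
proof -
  obtain S c T d where f: "f = Zsum S c" "finite S" "S \<subseteq> Collect finite"
    and g: "g = Zsum T d" "finite T" "T \<subseteq> Collect finite"
    using assms by (auto simp: Zspan_def)
  define b where "b = (\<lambda>\<sigma>. (if \<sigma> \<in> S then c \<sigma> else 0) + (if \<sigma> \<in> T then d \<sigma> else 0))"
  have "Zsum S c s + Zsum T d s = Zsum (S \<union> T) b s" for s
  proof -
    have "Zsum S c s = (\<Sum>\<sigma>\<in>S \<union> T. (if \<sigma> \<in> S then c \<sigma> else 0) * Zprod p \<sigma> s)"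
      unfolding Zsum_def using f(2) g(2) by (intro sum.mono_neutral_cong_left) auto
    moreover have "Zsum T d s = (\<Sum>\<sigma>\<in>S \<union> T. (if \<sigma> \<in> T then d \<sigma> else 0) * Zprod p \<sigma> s)"
      unfolding Zsum_def using f(2) g(2) by (intro sum.mono_neutral_cong_left) auto
    ultimately show ?thesis
      by (simp add: Zsum_def b_def sum.distrib[symmetric] distrib_right)
  qed
  then have "(\<lambda>s. f s + g s) = Zsum (S \<union> T) b"
    by (simp add: f(1) g(1) fun_eq_iff)
  then show ?thesis
    unfolding Zspan_def using f g by blast
qed

lemma Zspan_scale:
  assumes "f \<in> Zspan"
  shows "(\<lambda>s. a * f s) \<in> Zspan"
proof -
  obtain S c where f: "f = Zsum S c" "finite S" "S \<subseteq> Collect finite"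
    using assms by (auto simp: Zspan_def)
  have "(\<lambda>s. a * f s) = Zsum S (\<lambda>\<sigma>. a * c \<sigma>)"
    by (simp add: f(1) Zsum_def fun_eq_iff sum_distrib_left mult.assoc)
  then show ?thesis
    unfolding Zspan_def using f by blast
qed

lemma Zspan_subset_Zclosure: "g \<in> Zspan \<Longrightarrow> g \<in> Zclosure"
  by (auto simp: Zclosure_def Zspan_l2 intro!: bexI[of _ g]) (simp add: l2_inner_def)

lemma Zclosure_l2: "f \<in> Zclosure \<Longrightarrow> f \<in> l2 M"
  by (simp add: Zclosure_def)

lemma Zclosure_closed:
  assumes f: "f \<in> l2 M"
    and approx: "\<And>e. 0 < e \<Longrightarrow> \<exists>g\<in>Zclosure. l2_inner M (\<lambda>s. f s - g s) (\<lambda>s. f s - g s) < e"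
  shows "f \<in> Zclosure"
  unfolding Zclosure_def
proof (intro CollectI conjI allI impI f)
  fix e :: real assume e: "0 < e"
  obtain g where g: "g \<in> Zclosure" "l2_inner M (\<lambda>s. f s - g s) (\<lambda>s. f s - g s) < e / 4"
    using approx[of "e / 4"] e by auto
  obtain h where h: "h \<in> Zspan" "l2_inner M (\<lambda>s. g s - h s) (\<lambda>s. g s - h s) < e / 4"
    using g(1) e by (auto simp: Zclosure_def dest!: spec[of _ "e / 4"])
  have "l2_inner M (\<lambda>s. f s - h s) (\<lambda>s. f s - h s) < e"
    using l2_inner_add_self_le[of "\<lambda>s. f s - g s" M "\<lambda>s. g s - h s"] g(2) h(2) f
    by (simp add: l2_diff Zclosure_l2[OF g(1)] Zspan_l2[OF h(1)])
  then show "\<exists>h\<in>Zspan. l2_inner M (\<lambda>s. f s - h s) (\<lambda>s. f s - h s) < e"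
    using h(1) by blast
qed

lemma Zclosure_add:
  assumes f: "f \<in> Zclosure" and g: "g \<in> Zclosure"
  shows "(\<lambda>s. f s + g s) \<in> Zclosure"
proof (rule Zclosure_closed)
  show "(\<lambda>s. f s + g s) \<in> l2 M"
    using assms by (intro l2_add Zclosure_l2)
  fix e :: real assume e: "0 < e"
  obtain f' where f': "f' \<in> Zspan" "l2_inner M (\<lambda>s. f s - f' s) (\<lambda>s. f s - f' s) < e / 4"
    using f e by (auto simp: Zclosure_def dest!: spec[of _ "e / 4"])
  obtain g' where g': "g' \<in> Zspan" "l2_inner M (\<lambda>s. g s - g' s) (\<lambda>s. g s - g' s) < e / 4"
    using g e by (auto simp: Zclosure_def dest!: spec[of _ "e / 4"])
  have "l2_inner M (\<lambda>s. f s + g s - (f' s + g' s)) (\<lambda>s. f s + g s - (f' s + g' s)) < e"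
    using l2_inner_add_self_le[of "\<lambda>s. f s - f' s" M "\<lambda>s. g s - g' s"] f'(2) g'(2) f g
    by (simp add: l2_diff Zclosure_l2 Zspan_l2[OF f'(1)] Zspan_l2[OF g'(1)] add_diff_add)
  then show "\<exists>h\<in>Zclosure. l2_inner M (\<lambda>s. f s + g s - h s) (\<lambda>s. f s + g s - h s) < e"
    by (intro bexI[of _ "\<lambda>s. f' s + g' s"] Zspan_subset_Zclosure Zspan_add f'(1) g'(1))
qed

lemma Zclosure_scale:
  assumes f: "f \<in> Zclosure"
  shows "(\<lambda>s. a * f s) \<in> Zclosure"
proof (rule Zclosure_closed)
  show "(\<lambda>s. a * f s) \<in> l2 M"
    using assms by (intro l2_scale Zclosure_l2)
  fix e :: real assume e: "0 < e"
  have a: "0 < a\<^sup>2 + 1" by (smt (verit) zero_le_power2)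
  then obtain g where g: "g \<in> Zspan" "l2_inner M (\<lambda>s. f s - g s) (\<lambda>s. f s - g s) < e / (a\<^sup>2 + 1)"
    using f e by (auto simp: Zclosure_def dest!: spec[of _ "e / (a\<^sup>2 + 1)"])
  have "l2_inner M (\<lambda>s. a * f s - a * g s) (\<lambda>s. a * f s - a * g s) =
      a\<^sup>2 * l2_inner M (\<lambda>s. f s - g s) (\<lambda>s. f s - g s)"
    using l2_inner_scale_self[of M a "\<lambda>s. f s - g s"] by (simp add: right_diff_distrib)
  also have "\<dots> \<le> (a\<^sup>2 + 1) * l2_inner M (\<lambda>s. f s - g s) (\<lambda>s. f s - g s)"
    by (intro mult_right_mono l2_inner_self_nonneg) simp
  also have "\<dots> < e"
    using g(2) a by (simp add: pos_less_divide_eq mult.commute)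
  finally show "\<exists>h\<in>Zclosure. l2_inner M (\<lambda>s. a * f s - h s) (\<lambda>s. a * f s - h s) < e"
    by (intro bexI[of _ "\<lambda>s. a * g s"] Zspan_subset_Zclosure Zspan_scale g(1))
qed

lemma Zspan_zero: "(\<lambda>s. 0) \<in> Zspan"
  unfolding Zspan_def
  by (rule CollectI, rule exI[of _ "{}"], rule exI[of _ "\<lambda>_. 0"]) (simp add: Zsum_def fun_eq_iff)

lemma Zprod_Zspan: "finite \<sigma> \<Longrightarrow> Zprod p \<sigma> \<in> Zspan"
  unfolding Zspan_def
  by (rule CollectI, rule exI[of _ "{\<sigma>}"], rule exI[of _ "\<lambda>_. 1"]) (simp add: Zsum_def fun_eq_iff)

lemma Zclosure_sum:
  assumes "\<And>i. i \<in> I \<Longrightarrow> f i \<in> Zclosure"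
  shows "(\<lambda>s. \<Sum>i\<in>I. f i s) \<in> Zclosure"
  using assms
  by (induction I rule: infinite_finite_induct)
     (auto intro: Zclosure_add Zspan_subset_Zclosure Zspan_zero)

text \<open>Closure under dominated limits is the only analytic property of the closed span that the extension
  from cylinder sets to all of \<open>L\<^sup>2\<close> uses.\<close>

lemma Zclosure_dominated:
  assumes F: "\<And>n::nat. F n \<in> Zclosure" and f: "f \<in> borel_measurable M" and h: "h \<in> l2 M"
    and lim: "\<And>s. s \<in> space M \<Longrightarrow> (\<lambda>n. F n s) \<longlonglongrightarrow> f s"
    and bound: "\<And>n s. s \<in> space M \<Longrightarrow> \<bar>F n s\<bar> \<le> h s"
  shows "f \<in> Zclosure"
proof (rule Zclosure_closed)
  have f_bound: "\<bar>f s\<bar> \<le> h s" if "s \<in> space M" for s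
    by (rule LIMSEQ_le_const2[OF tendsto_rabs[OF lim[OF that]]]) (use bound[OF that] in auto)
  show f_l2: "f \<in> l2 M"
  proof (rule l2_dominated[OF f l2_square_integrable[OF h]])
    fix s assume "s \<in> space M"
    then show "(f s)\<^sup>2 \<le> (h s)\<^sup>2"
      using f_bound[of s] power_mono[of "\<bar>f s\<bar>" "h s" 2] by simp
  qed
  have "(\<lambda>n. \<integral>s. (f s - F n s)\<^sup>2 \<partial>M) \<longlonglongrightarrow> (\<integral>s. 0 \<partial>M)"
  proof (rule integral_dominated_convergence[where w = "\<lambda>s. 4 * (h s)\<^sup>2"])
    show "AE s in M. (\<lambda>n. (f s - F n s)\<^sup>2) \<longlonglongrightarrow> 0"
    proof (rule AE_I2)
      fix s assume "s \<in> space M"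
      from tendsto_power[OF tendsto_diff[OF tendsto_const[of "f s"] lim[OF this]], of 2]
      show "(\<lambda>n. (f s - F n s)\<^sup>2) \<longlonglongrightarrow> 0" by simp
    qed
    show "AE s in M. norm ((f s - F n s)\<^sup>2) \<le> 4 * (h s)\<^sup>2" for n
    proof (rule AE_I2)
      fix s assume "s \<in> space M"
      then have "\<bar>f s - F n s\<bar> \<le> 2 * h s"
        using f_bound[of s] bound[of s n] by linarith
      then show "norm ((f s - F n s)\<^sup>2) \<le> 4 * (h s)\<^sup>2"
        using power_mono[of "\<bar>f s - F n s\<bar>" "2 * h s" 2] by simp
    qed
    show "(\<lambda>s. (f s - F n s)\<^sup>2) \<in> borel_measurable M" for n
      by (intro borel_measurable_power borel_measurable_diff f l2_measurable Zclosure_l2 F)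
  qed (use h in \<open>auto simp: l2_square_integrable\<close>)
  then have lim0: "(\<lambda>n. l2_inner M (\<lambda>s. f s - F n s) (\<lambda>s. f s - F n s)) \<longlonglongrightarrow> 0"
    by (simp add: l2_inner_self)
  fix e :: real assume "0 < e"
  from order_tendstoD(2)[OF lim0 this]
  show "\<exists>g\<in>Zclosure. l2_inner M (\<lambda>s. f s - g s) (\<lambda>s. f s - g s) < e"
    using F by (auto simp: eventually_sequentially)
qed

text \<open>On two points every function is affine in the injective function \<open>Zvar p j\<close>. The
  coefficients used are the mean and the normalised difference of the indicator.\<close>

lemma indicator_coordinate_affine:
  "\<exists>a b. \<forall>s\<in>space M. indicator E (s j) = a + b * Zvar p j s"
proof -
  define r where "r = sqrt (p j * (1 - p j))"
  have r: "0 < r" using sqrt_pq_pos by (simp add: r_def)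
  define i0 i1 :: real where "i0 = indicator E (-1)" and "i1 = indicator E 1"
  have "indicator E (s j) = i1 * p j + i0 * (1 - p j) + (i1 - i0) * r * Zvar p j s"
    if "s \<in> space M" for s
  proof -
    have "r * Zvar p j s = (s j + 1 - 2 * p j) / 2"
      using r by (simp add: Zvar_def zeta_def Let_def r_def[symmetric])
    then have "(i1 - i0) * r * Zvar p j s = (i1 - i0) * ((s j + 1 - 2 * p j) / 2)"
      by (simp add: mult.assoc)
    moreover have "s j = 1 \<or> s j = - 1"
      using that by (auto simp: space_bernoulli_space)
    ultimately show ?thesis
      by (auto simp: i0_def i1_def algebra_simps)
  qed
  then show ?thesis by blast
qed

text \<open>The indicator of a cylinder is a finite product of affine functions of the \<open>Zvar p j\<close> for distinct
  \<open>j\<close>; expanding it gives a linear combination of products \<open>Zprod p B\<close>.\<close>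

lemma cylinder_indicator_Zclosure:
  assumes A: "A \<in> prod_algebra UNIV (\<lambda>n. sign_measure (p n))"
  shows "indicator A \<in> Zclosure"
proof -
  obtain J E where J: "A = prod_emb UNIV (\<lambda>n. sign_measure (p n)) J (\<Pi>\<^sub>E j\<in>J. E j)" "finite J"
    using A by (elim prod_algebraE) auto
  have A_sets: "A \<in> sets M"
    using A by (auto simp: bernoulli_space_def sets_PiM)
  obtain a b where ab: "\<And>j s. s \<in> space M \<Longrightarrow> indicator (E j) (s j) = a j + b j * Zvar p j s"
  proof -
    have "\<forall>j. \<exists>c. \<forall>s\<in>space M. indicator (E j) (s j) = fst c + snd c * Zvar p j s"
      using indicator_coordinate_affine by simp
    then obtain c where "\<forall>j. \<forall>s\<in>space M. indicator (E j) (s j) = fst (c j) + snd (c j) * Zvar p j s"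
      by (rule choice[THEN exE])
    then show thesis using that[of "\<lambda>j. fst (c j)" "\<lambda>j. snd (c j)"] by blast
  qed
  define F where "F s = (\<Sum>B\<in>Pow J. (\<Prod>j\<in>J - B. a j) * (\<Prod>j\<in>B. b j) * Zprod p B s)" for s
  have "indicator A s = F s" if s: "s \<in> space M" for s
  proof -
    have "indicator A s = (\<Prod>j\<in>J. indicator (E j) (s j) :: real)"
      using s J unfolding space_bernoulli_space
      by (auto simp: indicator_def prod_emb_def space_sign_measure PiE_def Pi_def extensional_def)
    also have "\<dots> = (\<Prod>j\<in>J. b j * Zvar p j s + a j)"
      using ab[OF s] by (simp add: add.commute)
    also have "\<dots> = F s"
      unfolding F_def by (subst prod_add[OF J(2)]) (simp add: Zprod_def prod.distrib mult_ac)
    finally show ?thesis .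
  qed
  then have eq: "F s = indicator A s" if "s \<in> space M" for s
    using that by simp
  have F: "F \<in> Zclosure"
    unfolding F_def[abs_def]
    by (intro Zclosure_sum Zclosure_scale Zspan_subset_Zclosure Zprod_Zspan)
       (use J(2) in \<open>auto intro: finite_subset\<close>)
  show ?thesis
  \<comment> \<open>\<open>F\<close> is the indicator only on the space; off the space \<open>F\<close> has other values.\<close>
  proof (rule Zclosure_dominated[where F = "\<lambda>_. F" and h = "\<lambda>_. 1"])
    show "indicator A \<in> borel_measurable M" using A_sets by simp
    show "\<bar>F s\<bar> \<le> 1" if "s \<in> space M" for s using eq[OF that] by simp
    show "(\<lambda>n. F s) \<longlonglongrightarrow> indicator A s" if "s \<in> space M" for s using eq[OF that] by simp
  qed (simp_all add: F l2_def)
qed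

lemma indicator_Zclosure:
  assumes "A \<in> sets M"
  shows "indicator A \<in> Zclosure"
proof -
  let ?G = "prod_algebra UNIV (\<lambda>n. sign_measure (p n))"
  have sets: "sets M = sigma_sets (space M) ?G"
    by (simp add: bernoulli_space_def sets_PiM space_PiM)
  have space: "indicator (space M) \<in> Zclosure"
  proof (rule Zclosure_dominated[where F = "\<lambda>_. Zprod p {}" and h = "\<lambda>_. 1"])
    show "Zprod p {} \<in> Zclosure"
      by (intro Zspan_subset_Zclosure Zprod_Zspan) simp
  qed (auto simp: Zprod_def l2_def)
  have G: "?G \<subseteq> Pow (space M)"
    using prod_algebra_sets_into_space[of UNIV "\<lambda>n. sign_measure (p n)"]
    by (simp add: bernoulli_space_def space_PiM)
  show ?thesis
    using Int_stable_prod_algebra G assms[unfolded sets]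
  proof (induction rule: sigma_sets_induct_disjoint)
    case (basic A)
    then show ?case by (rule cylinder_indicator_Zclosure)
  next
    case empty
    then show ?case using Zspan_subset_Zclosure[OF Zspan_zero] by (simp add: indicator_def[abs_def])
  next
    case (compl A)
    have "A \<subseteq> space M" using compl(1) sets sets.sets_into_space by blast
    then have "indicator (space M - A) = (\<lambda>s. indicator (space M) s + - 1 * indicator A s :: real)"
      by (auto simp: fun_eq_iff indicator_def)
    then show ?case using compl(2) space by (simp only:) (intro Zclosure_add Zclosure_scale)
  next
    case (union A)
    have A: "A i \<in> sets M" for i using union(2) sets by auto
    show ?case
    proof (rule Zclosure_dominated[where F = "\<lambda>n s. \<Sum>i<n. indicator (A i) s" and h = "\<lambda>_. 1"])
      have Un: "(\<Sum>i<n. indicator (A i) s) = (indicator (\<Union>i<n. A i) s :: real)" for n s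
        using union(1) by (subst indicator_UN_disjoint) (auto simp: disjoint_family_on_def)
      show "\<bar>\<Sum>i<n. indicator (A i) s\<bar> \<le> (1::real)" for n s
        unfolding Un by (simp add: indicator_def)
      show "(\<lambda>n. \<Sum>i<n. indicator (A i) s) \<longlonglongrightarrow> (indicator (\<Union>i. A i) s :: real)" for s
        unfolding Un by (rule LIMSEQ_indicator_UN)
      show "(\<lambda>s. \<Sum>i<n. indicator (A i) s) \<in> Zclosure" for n
        by (intro Zclosure_sum union(3))
    qed (use A in \<open>auto simp: l2_def\<close>)
  qed
qed

lemma Zclosure_eq_l2: "Zclosure = l2 M"
proof (intro equalityI subsetI)
  fix f assume f: "f \<in> l2 M"
  obtain F where F: "\<And>i. simple_function M (F i)"
      "\<And>s. s \<in> space M \<Longrightarrow> (\<lambda>i. F i s) \<longlonglongrightarrow> f s"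
      "\<And>i s. s \<in> space M \<Longrightarrow> \<bar>F i s\<bar> \<le> 2 * \<bar>f s\<bar>"
    using borel_measurable_implies_sequence_metric[OF l2_measurable[OF f], of 0]
    unfolding dist_real_def diff_0_right by blast
  show "f \<in> Zclosure"
  proof (rule Zclosure_dominated[where h = "\<lambda>s. 2 * \<bar>f s\<bar>"])
    fix n
    let ?G = "\<lambda>s. \<Sum>y\<in>F n ` space M. y * indicator (F n -` {y} \<inter> space M) s"
    \<comment> \<open>Off the space the values of \<open>F n\<close> are arbitrary, so they are cut off.\<close>
    show "(\<lambda>s. indicator (space M) s * F n s) \<in> Zclosure"
    proof -
      have "(\<lambda>s. indicator (space M) s * F n s) = ?G"
      proof
        fix s
        show "indicator (space M) s * F n s = ?G s"
        proof (cases "s \<in> space M")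
          case True
          then have "indicator (space M) s * F n s = F n s" by simp
          also have "\<dots> = ?G s"
            by (subst simple_function_indicator_representation_banach[OF F(1) True])
               (simp add: mult.commute)
          finally show ?thesis .
        qed simp
      qed
      moreover have "?G \<in> Zclosure"
        by (intro Zclosure_sum Zclosure_scale indicator_Zclosure simple_functionD(2) F(1))
      ultimately show ?thesis by simp
    qed
    show "\<bar>indicator (space M) s * F n s\<bar> \<le> 2 * \<bar>f s\<bar>" if "s \<in> space M" for s
      using F(3)[OF that, of n] that by simp
  next
    show "(\<lambda>n. indicator (space M) s * F n s) \<longlonglongrightarrow> f s" if "s \<in> space M" for s
      using F(2)[OF that] that by simp
    show "f \<in> borel_measurable M" by (rule l2_measurable[OF f])
    show "(\<lambda>s. 2 * \<bar>f s\<bar>) \<in> l2 M"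
      using f by (auto simp: l2_def power_mult_distrib)
  qed
qed (rule Zclosure_l2)

lemma Zspan_dense:
  assumes "f \<in> l2 M" "0 < e"
  obtains g where "g \<in> Zspan" "l2_inner M (\<lambda>s. f s - g s) (\<lambda>s. f s - g s) < e"
proof -
  have "f \<in> Zclosure" using assms(1) by (simp add: Zclosure_eq_l2)
  then show thesis using assms(2) that by (auto simp: Zclosure_def)
qed

section \<open>Parseval's identity\<close>

text \<open>Completing the square: among all coefficients the inner products \<open>\<langle>Z\<^sub>\<sigma>, f\<rangle>\<close> give the best approximation.
  This yields Bessel's inequality, and together with density Parseval's identity.\<close>

lemma Zsum_distance:
  assumes f: "f \<in> l2 M" and S: "finite S" "S \<subseteq> Collect finite"
  shows "l2_inner M (\<lambda>s. f s - Zsum S c s) (\<lambda>s. f s - Zsum S c s) =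
    l2_inner M f f - (\<Sum>\<sigma>\<in>S. (l2_inner M (Zprod p \<sigma>) f)\<^sup>2) +
    (\<Sum>\<sigma>\<in>S. (l2_inner M (Zprod p \<sigma>) f - c \<sigma>)\<^sup>2)"
proof -
  have inner: "l2_inner M (Zsum S c) g = (\<Sum>\<sigma>\<in>S. c \<sigma> * l2_inner M (Zprod p \<sigma>) g)"
    if "g \<in> l2 M" for g
    unfolding Zsum_def[abs_def] using that
    by (simp add: l2_inner_sum_left l2_scale Zprod_l2 l2_inner_scale_left)
  have coeff: "l2_inner M (Zprod p \<sigma>) (Zsum S c) = c \<sigma>" if "\<sigma> \<in> S" for \<sigma>
  proof -
    have "l2_inner M (Zprod p \<sigma>) (Zsum S c) = (\<Sum>\<tau>\<in>S. c \<tau> * l2_inner M (Zprod p \<tau>) (Zprod p \<sigma>))"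
      by (subst l2_inner_commute) (rule inner[OF Zprod_l2])
    also have "\<dots> = (\<Sum>\<tau>\<in>S. if \<tau> = \<sigma> then c \<tau> else 0)"
      using S that by (intro sum.cong) (auto simp: Zprod_orthonormal subset_iff)
    finally show ?thesis using S that by simp
  qed
  have "l2_inner M (\<lambda>s. f s - Zsum S c s) (\<lambda>s. f s - Zsum S c s) =
      l2_inner M f f - 2 * (\<Sum>\<sigma>\<in>S. c \<sigma> * l2_inner M (Zprod p \<sigma>) f) + (\<Sum>\<sigma>\<in>S. c \<sigma> * c \<sigma>)"
    by (simp add: l2_inner_diff_self f Zsum_l2 inner coeff)
  also have "\<dots> = l2_inner M f f - (\<Sum>\<sigma>\<in>S. (l2_inner M (Zprod p \<sigma>) f)\<^sup>2) +
    (\<Sum>\<sigma>\<in>S. (l2_inner M (Zprod p \<sigma>) f - c \<sigma>)\<^sup>2)"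
    by (simp add: power2_diff sum.distrib sum_subtractf sum_distrib_left power2_eq_square algebra_simps)
  finally show ?thesis .
qed

lemma bessel:
  assumes "f \<in> l2 M" "finite S" "S \<subseteq> Collect finite"
  shows "(\<Sum>\<sigma>\<in>S. (l2_inner M (Zprod p \<sigma>) f)\<^sup>2) \<le> l2_inner M f f"
  using Zsum_distance[OF assms, of "\<lambda>\<sigma>. l2_inner M (Zprod p \<sigma>) f"]
    l2_inner_self_nonneg[of M "\<lambda>s. f s - Zsum S (\<lambda>\<sigma>. l2_inner M (Zprod p \<sigma>) f) s"]
  by simp

lemma parseval:
  assumes f: "f \<in> l2 M"
  shows "((\<lambda>\<sigma>. (l2_inner M (Zprod p \<sigma>) f)\<^sup>2) has_sum l2_inner M f f) (Collect finite)"
  unfolding has_sum_def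
proof (rule order_tendstoI)
  fix a assume "a < l2_inner M f f"
  then obtain g where g: "g \<in> Zspan"
      "l2_inner M (\<lambda>s. f s - g s) (\<lambda>s. f s - g s) < l2_inner M f f - a"
    using Zspan_dense[OF f, of "l2_inner M f f - a"] by auto
  then obtain S c where S: "g = Zsum S c" "finite S" "S \<subseteq> Collect finite"
    by (auto simp: Zspan_def)
  have "a < (\<Sum>\<sigma>\<in>S. (l2_inner M (Zprod p \<sigma>) f)\<^sup>2)"
    using g(2) Zsum_distance[OF f S(2,3), of c]
      sum_nonneg[of S "\<lambda>\<sigma>. (l2_inner M (Zprod p \<sigma>) f - c \<sigma>)\<^sup>2"] by (simp add: S(1))
  moreover have "(\<Sum>\<sigma>\<in>S. (l2_inner M (Zprod p \<sigma>) f)\<^sup>2) \<le> (\<Sum>\<sigma>\<in>T. (l2_inner M (Zprod p \<sigma>) f)\<^sup>2)"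
    if "finite T" "S \<subseteq> T" for T
    using that by (intro sum_mono2) auto
  ultimately show "\<forall>\<^sub>F S in finite_subsets_at_top (Collect finite).
      a < (\<Sum>\<sigma>\<in>S. (l2_inner M (Zprod p \<sigma>) f)\<^sup>2)"
    unfolding eventually_finite_subsets_at_top using S by (intro exI[of _ S]) force
next
  fix a assume "l2_inner M f f < a"
  then show "\<forall>\<^sub>F S in finite_subsets_at_top (Collect finite).
      (\<Sum>\<sigma>\<in>S. (l2_inner M (Zprod p \<sigma>) f)\<^sup>2) < a"
    using bessel[OF f]
    by (intro eventually_finite_subsets_at_top_weakI) (auto intro: order_le_less_trans)
qed

text \<open>The coefficient of \<open>difference k f\<close> at \<open>\<sigma>\<close> is that of \<open>f\<close> at \<open>insert k \<sigma>\<close> if \<open>k \<notin> \<sigma>\<close>, and 0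
  otherwise.\<close>

lemma parseval_difference:
  assumes f: "f \<in> l2 M"
  shows "((\<lambda>\<sigma>. (l2_inner M (Zprod p \<sigma>) f)\<^sup>2) has_sum
    l2_inner M (difference k f) (difference k f)) {\<sigma>. finite \<sigma> \<and> k \<in> \<sigma>}"
proof -
  have "((\<lambda>\<sigma>. (l2_inner M (Zprod p \<sigma>) (difference k f))\<^sup>2) has_sum
      l2_inner M (difference k f) (difference k f)) (Collect finite)"
    by (intro parseval difference_l2 f)
  also have "?this \<longleftrightarrow> ((\<lambda>\<sigma>. (l2_inner M (Zprod p (insert k \<sigma>)) f)\<^sup>2) has_sum
      l2_inner M (difference k f) (difference k f)) {\<sigma>. finite \<sigma> \<and> k \<notin> \<sigma>}"
    by (intro has_sum_cong_neutral) (auto simp: inner_Zprod_difference f)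
  also have "\<dots> \<longleftrightarrow> ((\<lambda>\<sigma>. (l2_inner M (Zprod p \<sigma>) f)\<^sup>2) has_sum
      l2_inner M (difference k f) (difference k f)) {\<sigma>. finite \<sigma> \<and> k \<in> \<sigma>}"
  proof (intro has_sum_reindex_bij_betw[of "insert k"])
    show "bij_betw (insert k) {\<sigma>. finite \<sigma> \<and> k \<notin> \<sigma>} {\<sigma>. finite \<sigma> \<and> k \<in> \<sigma>}"
      by (intro bij_betw_byWitness[where f' = "\<lambda>\<sigma>. \<sigma> - {k}"]) auto
  qed
  finally show ?thesis .
qed


section \<open>The energy form in terms of differences\<close>

lemma difference_is_annihilation_operator: "is_annihilation_operator p k (difference k)"
proof -
  have "l2_norm M (difference k f) \<le> 1 * l2_norm M f" if "f \<in> l2 M" for f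
    using difference_norm_le[OF that] by (simp add: l2_norm_def)
  then have "l2_bounded_linear M (difference k)"
    unfolding l2_bounded_linear_def
    by (intro conjI ballI allI impI difference_l2 difference_AE_cong exI[of _ 1])
       (simp_all add: difference_add difference_scale)
  then show ?thesis
    by (simp add: is_annihilation_operator_def difference_Zprod)
qed

text \<open>\<open>T\<close> and \<open>difference k\<close> agree on the span of the products. Both are bounded, so an approximation of
  \<open>f\<close> by \<open>g\<close> in the span bounds the distance of \<open>T f\<close> and \<open>difference k f\<close> by a multiple of that of
  \<open>f\<close> and \<open>g\<close>.\<close>

lemma annihilation_operator_unique:
  assumes T: "is_annihilation_operator p k T" and f: "f \<in> l2 M"
  shows "AE s in M. T f s = difference k f s"
proof -
  have T_l2: "T g \<in> l2 M" if "g \<in> l2 M" for g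
    using T that by (simp add: is_annihilation_operator_def l2_bounded_linear_def)
  have T_add: "AE s in M. T (\<lambda>y. g y + h y) s = T g s + T h s" if "g \<in> l2 M" "h \<in> l2 M" for g h
    using T that by (simp add: is_annihilation_operator_def l2_bounded_linear_def)
  have T_scale: "AE s in M. T (\<lambda>y. a * g y) s = a * T g s" if "g \<in> l2 M" for g a
    using T that by (simp add: is_annihilation_operator_def l2_bounded_linear_def)
  have T_Zprod: "AE s in M. T (Zprod p \<sigma>) s = difference k (Zprod p \<sigma>) s" if "finite \<sigma>" for \<sigma>
    using T that by (simp add: is_annihilation_operator_def difference_Zprod)
  obtain K where norm_le: "\<And>g. g \<in> l2 M \<Longrightarrow> l2_norm M (T g) \<le> K * l2_norm M g"
    using T unfolding is_annihilation_operator_def l2_bounded_linear_def by blast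
  have K: "l2_inner M (T g) (T g) \<le> K\<^sup>2 * l2_inner M g g" if "g \<in> l2 M" for g
    using power_mono[OF norm_le[OF that], of 2]
    by (simp add: l2_norm_def l2_inner_self_nonneg power_mult_distrib)
  have T_Zsum: "AE s in M. T (Zsum S c) s = difference k (Zsum S c) s"
    if "finite S" "S \<subseteq> Collect finite" for S c
    using that
  proof (induction S rule: finite_induct)
    case empty
    \<comment> \<open>Homogeneity gives that \<open>T\<close> vanishes at 0.\<close>
    have "AE s in M. T (\<lambda>y. 0 * 0) s = 0 * T (\<lambda>y. 0) s"
      by (rule T_scale[OF l2_zero])
    then show ?case by (simp add: Zsum_def[abs_def] difference_def)
  next
    case (insert \<sigma> S)
    have Zsum: "Zsum (insert \<sigma> S) c = (\<lambda>s. c \<sigma> * Zprod p \<sigma> s + Zsum S c s)"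
      using insert by (simp add: Zsum_def fun_eq_iff)
    have "AE s in M. T (Zsum (insert \<sigma> S) c) s = T (\<lambda>s. c \<sigma> * Zprod p \<sigma> s) s + T (Zsum S c) s"
      unfolding Zsum by (intro T_add l2_scale Zprod_l2 Zsum_l2)
    moreover have "AE s in M. T (\<lambda>s. c \<sigma> * Zprod p \<sigma> s) s = c \<sigma> * T (Zprod p \<sigma>) s"
      by (intro T_scale Zprod_l2)
    moreover have "AE s in M. T (Zprod p \<sigma>) s = difference k (Zprod p \<sigma>) s"
      using insert by (intro T_Zprod) auto
    moreover have "AE s in M. T (Zsum S c) s = difference k (Zsum S c) s"
      using insert by auto
    ultimately show ?case
      by eventually_elim (simp add: Zsum difference_add difference_scale)
  qed
  let ?d = "\<lambda>s. T f s - difference k f s"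
  have "l2_inner M ?d ?d \<le> 0"
  proof (rule field_le_epsilon)
    fix e :: real assume e: "0 < e"
    \<comment> \<open>The factor by which the squared error of the approximation is enlarged below.\<close>
    have K_pos: "0 < 2 * (K\<^sup>2 + 1)" by (smt (verit) zero_le_power2)
    obtain g where g: "g \<in> Zspan"
        "l2_inner M (\<lambda>s. f s - g s) (\<lambda>s. f s - g s) < e / (2 * (K\<^sup>2 + 1))"
      using Zspan_dense[OF f, of "e / (2 * (K\<^sup>2 + 1))"] e K_pos by auto
    define h where "h = (\<lambda>s. f s - g s)"
    have g_l2: "g \<in> l2 M" and h: "h \<in> l2 M"
      using f Zspan_l2[OF g(1)] by (auto simp: h_def l2_diff)
    have "AE s in M. T (\<lambda>y. h y + g y) s = T h s + T g s"
      by (intro T_add h g_l2)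
    moreover have "AE s in M. T g s = difference k g s"
      using g(1) T_Zsum by (auto simp: Zspan_def)
    ultimately have "AE s in M. ?d s = T h s + - 1 * difference k h s"
      by eventually_elim (simp add: h_def difference_diff)
    then have "l2_inner M ?d ?d =
        l2_inner M (\<lambda>s. T h s + - 1 * difference k h s) (\<lambda>s. T h s + - 1 * difference k h s)"
      by (intro l2_inner_cong_AE l2_diff l2_add l2_scale T_l2 difference_l2 f h)
    also have "\<dots> \<le> 2 * l2_inner M (T h) (T h) + 2 * l2_inner M (\<lambda>s. - 1 * difference k h s) (\<lambda>s. - 1 * difference k h s)"
      by (intro l2_inner_add_self_le T_l2 l2_scale difference_l2 h)
    also have "\<dots> = 2 * l2_inner M (T h) (T h) + 2 * l2_inner M (difference k h) (difference k h)"
      unfolding l2_inner_scale_self by simp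
    also have "\<dots> \<le> 2 * (K\<^sup>2 * l2_inner M h h) + 2 * l2_inner M h h"
      by (intro add_mono mult_left_mono K difference_norm_le h) auto
    also have "\<dots> = l2_inner M h h * (2 * (K\<^sup>2 + 1))"
      by (simp add: algebra_simps)
    also have "\<dots> < e"
      using g(2) K_pos by (simp add: h_def pos_less_divide_eq)
    finally show "l2_inner M ?d ?d \<le> 0 + e" by simp
  qed
  then have "l2_inner M ?d ?d = 0"
    using l2_inner_self_nonneg[of M ?d] by simp
  then have "AE s in M. ?d s = 0"
    by (intro l2_inner_self_eq_0 l2_diff T_l2 difference_l2 f)
  then show ?thesis by simp
qed

lemma annihilation_operator: "is_annihilation_operator p k (annihilation p k)"
  unfolding annihilation_def
  by (rule someI[of "is_annihilation_operator p k"]) (rule difference_is_annihilation_operator)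

lemma energy_form_eq:
  assumes "f \<in> l2 M" "g \<in> l2 M"
  shows "energy_form p w f g = (\<Sum>k. w k * l2_inner M (difference k f) (difference k g))"
proof -
  have "annihilation p k h \<in> l2 M" if "h \<in> l2 M" for k h
    using annihilation_operator[of k] that
    by (simp add: is_annihilation_operator_def l2_bounded_linear_def)
  then have "l2_inner M (annihilation p k f) (annihilation p k g) =
      l2_inner M (difference k f) (difference k g)" for k
    using assms
    by (intro l2_inner_cong_AE difference_l2 annihilation_operator_unique[OF annihilation_operator])
  then show ?thesis by (simp add: energy_form_def)
qed

end

locale weighted_bernoulli = bernoulli +
  fixes w :: "nat \<Rightarrow> real"
  assumes w_nonneg: "\<And>k. 0 \<le> w k"
begin

abbreviation "D \<equiv> energy_domain p w"
abbreviation "E \<equiv> energy_form p w"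

text \<open>Tonelli's theorem for the nonnegative family \<open>w k * \<langle>Z\<^sub>\<sigma>, f\<rangle>\<^sup>2\<close> over the pairs with \<open>k \<in> \<sigma>\<close>: summing
  over \<open>k\<close> first gives the series that defines the domain, summing over \<open>\<sigma>\<close> first gives, by
  Parseval's identity for differences, the series on the right.\<close>

lemma energy_domain_iff:
  "f \<in> D \<longleftrightarrow> f \<in> l2 M \<and> summable (\<lambda>k. w k * l2_inner M (difference k f) (difference k f))"
proof (cases "f \<in> l2 M")
  case f: True
  define c where "c \<sigma> = (l2_inner M (Zprod p \<sigma>) f)\<^sup>2" for \<sigma>
  define h where "h = (\<lambda>(\<sigma>::nat set, k). w k * c \<sigma>)"
  have c: "0 \<le> c \<sigma>" for \<sigma> by (simp add: c_def)
  have count: "0 \<le> weighted_count w \<sigma>" for \<sigma>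
    by (simp add: weighted_count_def sum_nonneg w_nonneg)
  have c_sum: "(c has_sum l2_inner M (difference k f) (difference k f)) {\<sigma>. finite \<sigma> \<and> k \<in> \<sigma>}" for k
    using parseval_difference[OF f] by (simp add: c_def[abs_def])
  have "f \<in> D \<longleftrightarrow> (\<lambda>\<sigma>. weighted_count w \<sigma> * c \<sigma>) summable_on Collect finite"
    using f by (simp add: energy_domain_def c_def)
  also have "\<dots> \<longleftrightarrow> (\<lambda>\<sigma>. \<Sum>\<^sub>\<infinity>k\<in>\<sigma>. norm (h (\<sigma>, k))) summable_on Collect finite"
    by (intro summable_on_cong)
       (simp add: h_def weighted_count_def abs_mult c w_nonneg sum_distrib_right)
  also have "\<dots> \<longleftrightarrow> (\<lambda>x. norm (h x)) summable_on (SIGMA \<sigma>:Collect finite. \<sigma>)"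
    by (subst Infinite_Sum.abs_summable_on_Sigma_iff) (simp add: infsum_nonneg)
  also have "\<dots> \<longleftrightarrow> (\<lambda>x. norm (case x of (k, \<sigma>) \<Rightarrow> h (\<sigma>, k))) summable_on
      (SIGMA k:UNIV. {\<sigma>. finite \<sigma> \<and> k \<in> \<sigma>})"
  proof -
    have "bij_betw (\<lambda>(k, \<sigma>). (\<sigma>, k)) (SIGMA k:UNIV. {\<sigma>. finite \<sigma> \<and> k \<in> \<sigma>})
        (SIGMA \<sigma>:Collect finite. \<sigma>)"
      by (intro bij_betw_byWitness[where f' = "\<lambda>(\<sigma>, k). (k, \<sigma>)"]) auto
    from summable_on_reindex_bij_betw[OF this, of "\<lambda>x. norm (h x)"] show ?thesis
      by (simp add: case_prod_unfold)
  qed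
  also have "\<dots> \<longleftrightarrow> (\<lambda>k. \<Sum>\<^sub>\<infinity>\<sigma>\<in>{\<sigma>. finite \<sigma> \<and> k \<in> \<sigma>}. w k * c \<sigma>) summable_on UNIV"
    by (subst Infinite_Sum.abs_summable_on_Sigma_iff)
       (auto simp: h_def abs_mult c w_nonneg infsum_nonneg
          intro!: summable_on_cmult_right has_sum_imp_summable[OF c_sum])
  also have "\<dots> \<longleftrightarrow> (\<lambda>k. w k * l2_inner M (difference k f) (difference k f)) summable_on UNIV"
    by (intro summable_on_cong infsumI has_sum_cmult_right c_sum)
  also have "\<dots> \<longleftrightarrow> summable (\<lambda>k. w k * l2_inner M (difference k f) (difference k f))"
    by (intro summable_on_UNIV_nonneg_real_iff mult_nonneg_nonneg w_nonneg l2_inner_self_nonneg)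
  finally show ?thesis using f by simp
qed (simp add: energy_domain_def)

lemma domain_l2: "f \<in> D \<Longrightarrow> f \<in> l2 M"
  by (simp add: energy_domain_iff)

lemma domain_add:
  assumes "f \<in> D" "g \<in> D"
  shows "(\<lambda>s. f s + g s) \<in> D"
  unfolding energy_domain_iff
proof
  show "(\<lambda>s. f s + g s) \<in> l2 M"
    using assms by (intro l2_add domain_l2)
  show "summable (\<lambda>k. w k * l2_inner M (difference k (\<lambda>s. f s + g s)) (difference k (\<lambda>s. f s + g s)))"
  proof (rule summable_comparison_test')
    show "summable (\<lambda>k. 2 * (w k * l2_inner M (difference k f) (difference k f)) +
        2 * (w k * l2_inner M (difference k g) (difference k g)))"
      using assms by (intro summable_add summable_mult) (auto simp: energy_domain_iff)
    fix k
    have "w k * l2_inner M (difference k (\<lambda>s. f s + g s)) (difference k (\<lambda>s. f s + g s)) \<le>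
      w k * (2 * l2_inner M (difference k f) (difference k f) +
        2 * l2_inner M (difference k g) (difference k g))"
      unfolding difference_add_fun
      by (intro mult_left_mono w_nonneg l2_inner_add_self_le difference_l2 domain_l2 assms)
    then show "norm (w k * l2_inner M (difference k (\<lambda>s. f s + g s)) (difference k (\<lambda>s. f s + g s))) \<le>
      2 * (w k * l2_inner M (difference k f) (difference k f)) +
      2 * (w k * l2_inner M (difference k g) (difference k g))"
      by (simp add: abs_mult w_nonneg l2_inner_self_nonneg algebra_simps)
  qed
qed

lemma domain_scale:
  assumes "f \<in> D"
  shows "(\<lambda>s. a * f s) \<in> D"
  using assms unfolding energy_domain_iff difference_scale_fun l2_inner_scale_self
  by (auto simp: l2_scale mult.left_commute[of "w _"] intro!: summable_mult)

lemma domain_diff: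
  assumes "f \<in> D" "g \<in> D"
  shows "(\<lambda>s. f s - g s) \<in> D"
  using domain_add[OF assms(1) domain_scale[OF assms(2), of "-1"]] by simp

lemma domain_cong_AE:
  assumes "f \<in> D" "g \<in> l2 M" "AE s in M. f s = g s"
  shows "g \<in> D"
proof -
  have "l2_inner M (difference k g) (difference k g) = l2_inner M (difference k f) (difference k f)" for k
    using assms
    by (intro l2_inner_cong_AE difference_l2 difference_AE_cong) (auto simp: domain_l2 eq_commute)
  then show ?thesis using assms(1,2) by (simp add: energy_domain_iff)
qed

lemma Zspan_subset_domain:
  assumes "g \<in> Zspan"
  shows "g \<in> D"
proof -
  have Z: "Zprod p \<sigma> \<in> D" if "finite \<sigma>" for \<sigma>
  proof -
    have "difference k (Zprod p \<sigma>) = (\<lambda>s. 0)" if "k \<notin> \<sigma>" for k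
      using that \<open>finite \<sigma>\<close> by (simp add: difference_Zprod fun_eq_iff)
    then have "summable (\<lambda>k. w k * l2_inner M (difference k (Zprod p \<sigma>)) (difference k (Zprod p \<sigma>)))"
      by (intro summable_finite[OF that]) (simp add: l2_inner_def)
    then show ?thesis by (simp add: energy_domain_iff Zprod_l2)
  qed
  obtain S c where g: "g = Zsum S c" "finite S" "S \<subseteq> Collect finite"
    using assms by (auto simp: Zspan_def)
  have "Zsum S c \<in> D"
    using g(2,3)
  proof (induction S rule: finite_induct)
    case empty
    then show ?case by (simp add: Zsum_def[abs_def] energy_domain_iff l2_zero difference_def[abs_def] l2_inner_def)
  next
    case (insert \<sigma> S)
    then have "Zsum (insert \<sigma> S) c = (\<lambda>s. c \<sigma> * Zprod p \<sigma> s + Zsum S c s)"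
      by (simp add: Zsum_def fun_eq_iff)
    then show ?case using insert by (auto intro!: domain_add domain_scale Z)
  qed
  then show ?thesis by (simp add: g(1))
qed

lemma domain_subspace: "l2_subspace M D"
proof -
  have "(\<lambda>s. 0) \<in> D" by (rule Zspan_subset_domain[OF Zspan_zero])
  then show ?thesis
    unfolding l2_subspace_def by (auto intro: domain_l2 domain_cong_AE domain_add domain_scale)
qed

lemma domain_dense: "l2_dense M D"
  unfolding l2_dense_def
proof (intro ballI allI impI)
  fix f and e :: real assume f: "f \<in> l2 M" and e: "0 < e"
  obtain g where g: "g \<in> Zspan" "l2_inner M (\<lambda>s. f s - g s) (\<lambda>s. f s - g s) < e\<^sup>2"
    using Zspan_dense[OF f, of "e\<^sup>2"] e by auto
  have "l2_norm M (\<lambda>s. f s - g s) < e"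
    unfolding l2_norm_def using real_sqrt_less_mono[OF g(2)] e by simp
  then show "\<exists>g\<in>D. l2_norm M (\<lambda>x. f x - g x) < e"
    using Zspan_subset_domain[OF g(1)] by blast
qed

lemma energy_summable:
  assumes "f \<in> D" "g \<in> D"
  shows "summable (\<lambda>k. w k * l2_inner M (difference k f) (difference k g))"
proof (rule summable_comparison_test', rule summable_add)
  show "summable (\<lambda>k. w k * l2_inner M (difference k f) (difference k f))"
    "summable (\<lambda>k. w k * l2_inner M (difference k g) (difference k g))"
    using assms by (auto simp: energy_domain_iff)
  fix k
  have "\<bar>l2_inner M (difference k f) (difference k g)\<bar> \<le>
    l2_inner M (difference k f) (difference k f) + l2_inner M (difference k g) (difference k g)"
    using two_l2_inner_le[OF difference_l2 difference_l2, of f g k k] assms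
    by (simp add: domain_l2)
  from mult_left_mono[OF this w_nonneg[of k]]
  show "norm (w k * l2_inner M (difference k f) (difference k g)) \<le>
      w k * l2_inner M (difference k f) (difference k f) +
      w k * l2_inner M (difference k g) (difference k g)"
    by (simp add: abs_mult w_nonneg distrib_left)
qed

lemma energy_symmetric:
  assumes "f \<in> l2 M" "g \<in> l2 M"
  shows "E f g = E g f"
  using assms by (simp add: energy_form_eq l2_inner_commute)

lemma energy_add_left:
  assumes "f \<in> D" "g \<in> D" "h \<in> D"
  shows "E (\<lambda>s. f s + g s) h = E f h + E g h"
proof -
  have "E (\<lambda>s. f s + g s) h = (\<Sum>k. w k * l2_inner M (difference k f) (difference k h) +
      w k * l2_inner M (difference k g) (difference k h))"
    using assms
    by (simp add: energy_form_eq domain_l2 l2_add difference_add_fun l2_inner_add_left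
        difference_l2 distrib_left)
  also have "\<dots> = E f h + E g h"
    using assms by (simp add: suminf_add[symmetric] energy_summable energy_form_eq domain_l2)
  finally show ?thesis .
qed

lemma energy_scale_left:
  assumes "f \<in> D" "h \<in> D"
  shows "E (\<lambda>s. a * f s) h = a * E f h"
  using assms suminf_mult[OF energy_summable[OF assms], of a]
  by (simp add: energy_form_eq domain_l2 l2_scale difference_scale_fun l2_inner_scale_left
      mult.left_commute)

lemma energy_cong_AE:
  assumes "f \<in> D" "f' \<in> D" "g \<in> D" "g' \<in> D" "AE s in M. f s = f' s" "AE s in M. g s = g' s"
  shows "E f g = E f' g'"
proof -
  have "l2_inner M (difference k f) (difference k g) = l2_inner M (difference k f') (difference k g')" for k
    using assms by (intro l2_inner_cong_AE difference_l2 difference_AE_cong) (auto simp: domain_l2)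
  then show ?thesis using assms by (simp add: energy_form_eq domain_l2)
qed

lemma energy_nonneg:
  assumes "f \<in> D"
  shows "0 \<le> E f f"
  using assms energy_summable[OF assms assms]
  by (simp add: energy_form_eq domain_l2) (intro suminf_nonneg mult_nonneg_nonneg w_nonneg l2_inner_self_nonneg)

lemma energy_bilinear: "bilinear_form_on M D E"
proof -
  have right_add: "E f (\<lambda>s. g s + h s) = E f g + E f h" if "f \<in> D" "g \<in> D" "h \<in> D" for f g h
    using that energy_add_left[of g h f] by (simp add: energy_symmetric[of f] domain_l2 l2_add)
  have right_scale: "E f (\<lambda>s. a * g s) = a * E f g" if "f \<in> D" "g \<in> D" for f g a
    using that energy_scale_left[of g f a] by (simp add: energy_symmetric[of f] domain_l2 l2_scale)
  show ?thesis
    unfolding bilinear_form_on_def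
    by (intro conjI ballI allI impI energy_add_left energy_scale_left right_add right_scale energy_cong_AE)
qed

section \<open>Closedness\<close>

lemma difference_measurable:
  assumes "g \<in> borel_measurable M"
  shows "difference k g \<in> borel_measurable M"
  using measurable_compose[OF update_measurable_section[of 1 k] assms]
    measurable_compose[OF update_measurable_section[of "-1" k] assms]
  by (auto simp: difference_def[abs_def])

text \<open>Fatou's lemma is applied to the integrand of the form truncated to the first \<open>K\<close> coordinates, which
  is a finite sum and hence passes to the limit pointwise. The resulting bound does not depend on
  \<open>K\<close>, so that the full series converges and obeys the same bound.\<close>

lemma energy_lower_semicontinuous:
  fixes g :: "nat \<Rightarrow> (nat \<Rightarrow> real) \<Rightarrow> real"
  assumes g: "\<And>i. g i \<in> D" and h: "h \<in> borel_measurable M"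
    and lim: "AE s in M. (\<lambda>i. g i s) \<longlonglongrightarrow> h s"
    and bound: "\<And>i. E (g i) (g i) + l2_inner M (g i) (g i) \<le> c"
  shows "h \<in> D" "E h h + l2_inner M h h \<le> c"
proof -
  \<comment> \<open>The integral of this density is the truncation of the quadratic form.\<close>
  define \<phi> where "\<phi> K f s = (f s)\<^sup>2 + (\<Sum>k<K. w k * (difference k f s)\<^sup>2)"
    for K :: nat and f :: "(nat \<Rightarrow> real) \<Rightarrow> real" and s
  have \<phi>_nonneg: "0 \<le> \<phi> K f s" for K f s
    unfolding \<phi>_def by (intro add_nonneg_nonneg sum_nonneg mult_nonneg_nonneg w_nonneg) auto
  have \<phi>_measurable: "\<phi> K f \<in> borel_measurable M" if "f \<in> borel_measurable M" for K f
    unfolding \<phi>_def[abs_def] using that difference_measurable[OF that]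
    by (intro borel_measurable_add borel_measurable_sum borel_measurable_times borel_measurable_power) auto
  have \<phi>_integrable: "integrable M (\<phi> K f)" if "f \<in> l2 M" for K f
    unfolding \<phi>_def[abs_def]
    by (intro Bochner_Integration.integrable_add Bochner_Integration.integrable_sum
        integrable_mult_right l2_square_integrable difference_l2 that)
  have \<phi>_integral: "(\<integral>s. \<phi> K f s \<partial>M) =
      l2_inner M f f + (\<Sum>k<K. w k * l2_inner M (difference k f) (difference k f))"
    if "f \<in> l2 M" for K f
    unfolding \<phi>_def l2_inner_self using that
    by (simp add: l2_square_integrable difference_l2)
  have \<phi>_nn_integral: "(\<integral>\<^sup>+s. \<phi> K h s \<partial>M) \<le> ennreal c" for K
  proof -
    have "AE s in M. (\<lambda>i. difference k (g i) s) \<longlonglongrightarrow> difference k h s" for k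
    proof -
      have "AE s in M. (\<lambda>i. g i (s(k := 1))) \<longlonglongrightarrow> h (s(k := 1))"
        "AE s in M. (\<lambda>i. g i (s(k := -1))) \<longlonglongrightarrow> h (s(k := -1))"
        using AE_update[OF lim] by simp_all
      then show ?thesis
        by eventually_elim (auto simp: difference_def intro!: tendsto_intros)
    qed
    then have "AE s in M. \<forall>k. (\<lambda>i. difference k (g i) s) \<longlonglongrightarrow> difference k h s"
      by (simp add: AE_all_countable)
    with lim have "AE s in M. (\<lambda>i. ennreal (\<phi> K (g i) s)) \<longlonglongrightarrow> ennreal (\<phi> K h s)"
      by eventually_elim (auto simp: \<phi>_def intro!: tendsto_ennrealI tendsto_intros)
    then have "AE s in M. ennreal (\<phi> K h s) = liminf (\<lambda>i. ennreal (\<phi> K (g i) s))"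
      by eventually_elim (simp add: lim_imp_Liminf)
    then have "(\<integral>\<^sup>+s. \<phi> K h s \<partial>M) = (\<integral>\<^sup>+s. liminf (\<lambda>i. ennreal (\<phi> K (g i) s)) \<partial>M)"
      by (rule nn_integral_cong_AE)
    also have "\<dots> \<le> liminf (\<lambda>i. \<integral>\<^sup>+s. \<phi> K (g i) s \<partial>M)"
      using g by (intro nn_integral_liminf measurable_compose[OF \<phi>_measurable measurable_ennreal])
        (auto intro: l2_measurable domain_l2)
    also have "\<dots> \<le> liminf (\<lambda>i::nat. ennreal c)"
    proof (intro Liminf_mono always_eventually allI)
      fix i
      have "(\<integral>\<^sup>+s. \<phi> K (g i) s \<partial>M) = ennreal (\<integral>s. \<phi> K (g i) s \<partial>M)"
        by (intro nn_integral_eq_integral \<phi>_integrable domain_l2 g AE_I2 \<phi>_nonneg)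
      also have "(\<integral>s. \<phi> K (g i) s \<partial>M) \<le> l2_inner M (g i) (g i) + E (g i) (g i)"
        using g[of i] sum_le_suminf[OF energy_summable[OF g[of i] g[of i]], of "{..<K}"]
        by (simp add: \<phi>_integral domain_l2 energy_form_eq w_nonneg l2_inner_self_nonneg)
      then have "ennreal (\<integral>s. \<phi> K (g i) s \<partial>M) \<le> ennreal c"
        using bound[of i] by (intro ennreal_leI) simp
      finally show "(\<integral>\<^sup>+s. \<phi> K (g i) s \<partial>M) \<le> ennreal c" .
    qed
    also have "\<dots> = ennreal c" by (simp add: Liminf_const)
    finally show ?thesis .
  qed
  \<comment> \<open>Truncation at \<open>K = 0\<close> leaves just the square.\<close>
  have "integrable M (\<lambda>s. (h s)\<^sup>2)"
  proof (rule integrableI_nonneg)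
    have "(\<integral>\<^sup>+s. ennreal ((h s)\<^sup>2) \<partial>M) \<le> ennreal c"
      using \<phi>_nn_integral[of 0] by (simp add: \<phi>_def)
    then show "(\<integral>\<^sup>+s. ennreal ((h s)\<^sup>2) \<partial>M) < \<infinity>"
      by (rule order_le_less_trans) simp
  qed (use h in auto)
  then have h_l2: "h \<in> l2 M" using h by (simp add: l2_def)
  have "0 \<le> E (g 0) (g 0) + l2_inner M (g 0) (g 0)"
    by (intro add_nonneg_nonneg energy_nonneg g l2_inner_self_nonneg)
  then have c: "0 \<le> c" using bound[of 0] by simp
  have partial: "(\<Sum>k<K. w k * l2_inner M (difference k h) (difference k h)) \<le> c - l2_inner M h h" for K
  proof -
    have "ennreal (\<integral>s. \<phi> K h s \<partial>M) = (\<integral>\<^sup>+s. \<phi> K h s \<partial>M)"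
      by (intro nn_integral_eq_integral[symmetric] \<phi>_integrable h_l2 AE_I2 \<phi>_nonneg)
    also have "\<dots> \<le> ennreal c" by (rule \<phi>_nn_integral)
    finally show ?thesis using c by (simp add: \<phi>_integral h_l2)
  qed
  then have "summable (\<lambda>k. w k * l2_inner M (difference k h) (difference k h))"
    by (intro summableI_nonneg_bounded mult_nonneg_nonneg w_nonneg l2_inner_self_nonneg)
  then show "h \<in> D" by (simp add: energy_domain_iff h_l2)
  have "E h h \<le> c - l2_inner M h h"
    unfolding energy_form_eq[OF h_l2 h_l2]
    by (intro suminf_le_const energy_summable \<open>h \<in> D\<close> partial)
  then show "E h h + l2_inner M h h \<le> c" by simp
qed

text \<open>The limit is found as an almost everywhere limit of a subsequence. For \<open>n\<close> far out, \<open>X n - f\<close> is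
  the limit of the differences of \<open>X n\<close> with later members of that subsequence, which are
  uniformly small in the norm of the form; lower semicontinuity transfers the bound to \<open>X n - f\<close>.\<close>

lemma energy_complete:
  assumes X: "\<And>n::nat. X n \<in> D"
    and Cauchy: "\<And>e. 0 < e \<Longrightarrow> \<exists>N. \<forall>m\<ge>N. \<forall>n\<ge>N.
       sqrt (E (\<lambda>s. X m s - X n s) (\<lambda>s. X m s - X n s) +
         l2_inner M (\<lambda>s. X m s - X n s) (\<lambda>s. X m s - X n s)) < e"
  shows "\<exists>f\<in>D. (\<lambda>n. sqrt (E (\<lambda>s. X n s - f s) (\<lambda>s. X n s - f s) +
         l2_inner M (\<lambda>s. X n s - f s) (\<lambda>s. X n s - f s))) \<longlonglongrightarrow> 0"
proof -
  define Q where "Q h = E h h + l2_inner M h h" for h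
  have Q_Cauchy: "\<exists>N. \<forall>m\<ge>N. \<forall>n\<ge>N. sqrt (Q (\<lambda>s. X m s - X n s)) < e" if "0 < e" for e
    using Cauchy[OF that] by (simp add: Q_def)
  have Q_nonneg: "0 \<le> Q h" if "h \<in> D" for h
    unfolding Q_def by (intro add_nonneg_nonneg energy_nonneg that l2_inner_self_nonneg)
  have X_l2: "X n \<in> l2 M" for n by (intro domain_l2 X)
  obtain r :: "nat \<Rightarrow> nat" where r: "strict_mono r" "AE s in M. Cauchy (\<lambda>i. X (r i) s)"
  proof (rule cauchy_L1_AE_cauchy_subseq[of M X])
    show "integrable M (X n)" for n
      using l2_mult_integrable[OF X_l2, of "\<lambda>s. 1" n] by (simp add: l2_def)
    fix e :: real assume "0 < e"
    then obtain N where N: "\<And>m n. m \<ge> N \<Longrightarrow> n \<ge> N \<Longrightarrow> sqrt (Q (\<lambda>s. X m s - X n s)) < e"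
      using Q_Cauchy by blast
    have "(\<integral>s. norm (X m s - X n s) \<partial>M) < e" if mn: "m \<ge> N" "n \<ge> N" for m n
    proof -
      have "(\<integral>s. norm (X m s - X n s) \<partial>M) \<le> sqrt (l2_inner M (\<lambda>s. X m s - X n s) (\<lambda>s. X m s - X n s))"
        using l1_le_l2[OF l2_diff[OF X_l2 X_l2]] by simp
      also have "\<dots> \<le> sqrt (Q (\<lambda>s. X m s - X n s))"
        unfolding Q_def by (intro real_sqrt_le_mono) (simp add: energy_nonneg domain_diff X)
      also have "\<dots> < e" by (rule N[OF mn])
      finally show ?thesis .
    qed
    then show "\<exists>N. \<forall>i\<ge>N. \<forall>j\<ge>N. (\<integral>s. norm (X i s - X j s) \<partial>M) < e" by blast
  qed blast
  define f where "f s = lim (\<lambda>i. X (r i) s)" for s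
  have f: "f \<in> borel_measurable M"
    unfolding f_def[abs_def] by (intro borel_measurable_lim_metric l2_measurable X_l2)
  have lim: "AE s in M. (\<lambda>i. X (r i) s) \<longlonglongrightarrow> f s"
    using r(2) by eventually_elim (simp add: f_def Cauchy_convergent_iff convergent_LIMSEQ_iff)
  have close: "(\<lambda>s. X n s - f s) \<in> D \<and> Q (\<lambda>s. X n s - f s) \<le> e\<^sup>2"
    if N: "\<And>m n. m \<ge> N \<Longrightarrow> n \<ge> N \<Longrightarrow> sqrt (Q (\<lambda>s. X m s - X n s)) < e" and n: "n \<ge> N"
    for e N n
  proof -
    let ?g = "\<lambda>i s. X n s - X (r (i + N)) s"
    have g: "?g i \<in> D" for i by (intro domain_diff X)
    have meas: "(\<lambda>s. X n s - f s) \<in> borel_measurable M"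
      by (intro borel_measurable_diff f l2_measurable X_l2)
    have lim_g: "AE s in M. (\<lambda>i. ?g i s) \<longlonglongrightarrow> X n s - f s"
      using lim
    proof eventually_elim
      fix s assume "(\<lambda>i. X (r i) s) \<longlonglongrightarrow> f s"
      from tendsto_diff[OF tendsto_const LIMSEQ_ignore_initial_segment[OF this, of N]]
      show "(\<lambda>i. ?g i s) \<longlonglongrightarrow> X n s - f s" .
    qed
    have bound: "E (?g i) (?g i) + l2_inner M (?g i) (?g i) \<le> e\<^sup>2" for i
    proof -
      have "r (i + N) \<ge> N" using seq_suble[OF r(1), of "i + N"] by linarith
      then have "sqrt (Q (?g i)) \<le> e" using N[OF n] by (simp add: less_imp_le)
      then have "Q (?g i) \<le> e\<^sup>2" by (rule sqrt_le_D)
      then show ?thesis by (simp add: Q_def)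
    qed
    show ?thesis
      using energy_lower_semicontinuous[of ?g, OF g meas lim_g bound] by (simp add: Q_def)
  qed
  obtain N where "\<forall>m\<ge>N. \<forall>n\<ge>N. sqrt (Q (\<lambda>s. X m s - X n s)) < 1"
    using Q_Cauchy[OF zero_less_one] by blast
  then have "(\<lambda>s. X N s - f s) \<in> D"
    using close[of N 1 N] by blast
  from domain_diff[OF X[of N] this] have f_D: "f \<in> D" by simp
  have "(\<lambda>n. sqrt (Q (\<lambda>s. X n s - f s))) \<longlonglongrightarrow> 0"
  proof (rule LIMSEQ_I)
    fix e :: real assume e: "0 < e"
    obtain N where N: "\<And>m n. m \<ge> N \<Longrightarrow> n \<ge> N \<Longrightarrow> sqrt (Q (\<lambda>s. X m s - X n s)) < e / 2"
      using Q_Cauchy[OF half_gt_zero[OF e]] by blast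
    have "norm (sqrt (Q (\<lambda>s. X n s - f s)) - 0) < e" if "n \<ge> N" for n
    proof -
      have "sqrt (Q (\<lambda>s. X n s - f s)) \<le> e / 2"
        using close[OF N that] e by (intro real_le_lsqrt) simp_all
      then show ?thesis using e Q_nonneg[OF domain_diff[OF X f_D], of n] by simp
    qed
    then show "\<exists>N. \<forall>n\<ge>N. norm (sqrt (Q (\<lambda>s. X n s - f s)) - 0) < e" by blast
  qed
  then show ?thesis using f_D by (auto simp: Q_def)
qed

lemma energy_closed: "closed_form_on M D E"
proof -
  have inner: "bilinear_form_on M D (l2_inner M)"
  proof -
    have right_add: "l2_inner M f (\<lambda>s. g s + h s) = l2_inner M f g + l2_inner M f h"
      if "f \<in> D" "g \<in> D" "h \<in> D" for f g h
      using l2_inner_add_left[of g M h f] that by (simp add: l2_inner_commute[of M f] domain_l2)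
    have right_scale: "l2_inner M f (\<lambda>s. a * g s) = a * l2_inner M f g" for f g a
      by (simp add: l2_inner_commute[of M f] l2_inner_scale_left)
    show ?thesis
      unfolding bilinear_form_on_def
      by (intro conjI ballI allI impI l2_inner_add_left l2_inner_scale_left right_add right_scale
          l2_inner_cong_AE domain_l2)
  qed
  have bilinear: "bilinear_form_on M D (\<lambda>f g. E f g + l2_inner M f g)"
    by (rule bilinear_form_on_add[OF energy_bilinear inner])
  show ?thesis
    unfolding closed_form_on_def hilbert_space_on_def
  proof (intro conjI ballI impI allI domain_subspace bilinear)
    show "symmetric_form_on D (\<lambda>f g. E f g + l2_inner M f g)"
      by (simp add: symmetric_form_on_def energy_symmetric domain_l2 l2_inner_commute)
    show "positive_form_on D (\<lambda>f g. E f g + l2_inner M f g)"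
      by (simp add: positive_form_on_def energy_nonneg l2_inner_self_nonneg)
    show "AE s in M. f s = 0" if "f \<in> D" "E f f + l2_inner M f f = 0" for f
      using that energy_nonneg[of f] l2_inner_self_nonneg[of M f]
      by (intro l2_inner_self_eq_0 domain_l2) auto
  qed (intro energy_complete; blast)
qed

section \<open>The contraction property\<close>

lemma energy_contraction: "contraction_property D E"
  unfolding contraction_property_def
proof (intro allI impI ballI)
  fix C f assume C: "contraction_function C" and f: "f \<in> D"
  have lip: "\<bar>C a - C b\<bar> \<le> \<bar>a - b\<bar>" for a b
    using C by (simp add: contraction_function_def)
  have C0: "\<bar>C a\<bar> \<le> \<bar>a\<bar>" for a
    using C lip[of a 0] by (simp add: contraction_function_def)
  have "continuous_on UNIV C"
  proof (rule continuous_onI)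
    fix x e :: real assume "0 < e"
    then show "\<exists>d>0. \<forall>y\<in>UNIV. dist y x < d \<longrightarrow> dist (C y) (C x) \<le> e"
      using lip by (intro exI[of _ e]) (force simp: dist_real_def intro: order_trans[OF lip])
  qed
  then have C_meas: "C \<in> borel_measurable borel"
    by (rule borel_measurable_continuous_onI)
  have Cf: "C \<circ> f \<in> l2 M"
  proof (rule l2_dominated)
    show "C \<circ> f \<in> borel_measurable M"
      using measurable_comp[OF l2_measurable[OF domain_l2[OF f]] C_meas] .
    show "((C \<circ> f) s)\<^sup>2 \<le> (f s)\<^sup>2" for s
      using C0[of "f s"] by (simp add: abs_le_square_iff)
  qed (use f in \<open>simp add: domain_l2 l2_square_integrable\<close>)
  have pointwise: "\<bar>difference k (C \<circ> f) s\<bar> \<le> \<bar>difference k f s\<bar>" for k s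
    unfolding difference_def abs_mult by (intro mult_left_mono) (simp_all add: lip)
  have le: "w k * l2_inner M (difference k (C \<circ> f)) (difference k (C \<circ> f)) \<le>
      w k * l2_inner M (difference k f) (difference k f)" for k
    using f Cf by (intro mult_left_mono l2_inner_mono difference_l2 pointwise w_nonneg) (auto simp: domain_l2)
  have "summable (\<lambda>k. w k * l2_inner M (difference k (C \<circ> f)) (difference k (C \<circ> f)))"
    by (rule summable_comparison_test'[OF energy_summable[OF f f]])
       (simp add: abs_mult w_nonneg l2_inner_self_nonneg le)
  then have CfD: "C \<circ> f \<in> D" using Cf by (simp add: energy_domain_iff)
  have "E (C \<circ> f) (C \<circ> f) \<le> E f f"
    using f Cf by (simp add: energy_form_eq domain_l2)
      (intro suminf_le le energy_summable f CfD)
  with CfD show "C \<circ> f \<in> D \<and> E (C \<circ> f) (C \<circ> f) \<le> E f f" ..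
qed

lemma energy_dirichlet: "dirichlet_form M D E"
  unfolding dirichlet_form_def symmetric_form_on_def positive_form_on_def
  by (intro conjI ballI domain_subspace energy_bilinear domain_dense energy_symmetric
      energy_nonneg energy_closed energy_contraction domain_l2)

end

theorem corollary4p5:
  fixes p w :: "nat \<Rightarrow> real"
  assumes "\<And>n. 0 < p n" and "\<And>n. p n < 1"
    and "\<And>j. 0 \<le> w j"
  shows "dirichlet_form (bernoulli_space p) (energy_domain p w) (energy_form p w)"
proof -
  interpret weighted_bernoulli p w
    by unfold_locales (fact assms)+
  show ?thesis by (rule energy_dirichlet)
qed

end
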